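(* Let $\Sigma$ be a finite subset of $\mathbf{N}^*$ such that $|\Sigma|<q$. If $\Sigma\neq\emptyset$, then the map $\mathcal{G}_\Sigma:\mathcal{Z}^{\mathrm{triv}}_\Sigma(K)\to\mathcal{Z}_\emptyset(K)$ is not injective.
   Context: Notation. $\mathbf{N}$ is the set of non-negative integers, $\mathbf{N}^*$ the set of positive integers. $\mathbf{F}_q$ is a finite field with $q$ elements, $A=\mathbf{F}_q[\theta]$, $A^+$ is the set of monic polynomials in $A$, $K=\mathbf{F}_q(\theta)$, $K_\infty=\mathbf{F}_q((1/\theta))$ is the completion of $K$ for the valuation $v_\infty(a/b)=\deg b-\deg a$, and $\mathbf{C}_\infty$ is the completion of an algebraic closure of $K_\infty$. Put $\ell_d=\prod_{i=1}^d(\theta-\theta^{q^i})$, $D_d=\prod_{i=0}^{d-1}(\theta^{q^d}-\theta^{q^i})$ for $d\in\mathbf{N}$ (empty products are $1$; empty sums are $0$). Let $(t_i)_{i\in\mathbf{N}^*}$ and $(X_i)_{i\in\mathbf{N}^*}$ be sequences of independent indeterminates. For $a\in A$, $a(t_i)$ is obtained by replacing $\theta$ by $t_i$. For a finite subset $U\subset\mathbf{N}^*$ put $\chi_U(a)=\prod_{i\in U}a(t_i)$ and $X_U=\prod_{i\in U}X_i$. Fix a finite $\Sigma\subset\mathbf{N}^*$ with $|\Sigma|<q$. An admissible array of type $\Sigma$ and weight $w$ is $\mathtt{A}=\begin{pmatrix}\Sigma_1&\cdots&\Sigma_r\\ s_1&\cdots&s_r\end{pmatrix}$ where $\Sigma_1,\dots,\Sigma_r$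 are (possibly empty) pairwise disjoint sets with union $\Sigma$, and $s_1,\dots,s_r$ are positive integers with sum $w$ (for $\Sigma=\emptyset$ the empty array, with value $1$ and weight $0$, is also allowed). Define $$\zeta_A(\mathtt{A})=\sum\frac{\chi_{\Sigma_1}(a_1)\cdots\chi_{\Sigma_r}(a_r)}{a_1^{s_1}\cdots a_r^{s_r}},\qquad \lambda_A(\mathtt{A})=\sum\frac{X_{\Sigma_1}^{q^{\deg a_1}}\cdots X_{\Sigma_r}^{q^{\deg a_r}}}{a_1^{s_1}\cdots a_r^{s_r}},$$ both sums over $a_1,\dots,a_r\in A^+$ with $\deg a_1>\cdots>\deg a_r\ge 0$. The first (a Pellarin multiple zeta value) is an entire function of the variables $t_i$, $i\in\Sigma$; the second (a multiple polylogarithm) is an element of the Tate algebra over $\mathbf{C}_\infty$ in the variables $X_i$, $i\in\Sigma$. Let $\mathcal{Z}_\Sigma(K)$ (resp. $\mathcal{L}_\Sigma(K)$) be the $K$-vector space spanned by all $\zeta_A(\mathtt{A})$ (resp. $\lambda_A(\mathtt{A})$) with $\mathtt{A}$ admissible of type $\Sigma$, and $\mathcal{Z}_{\Sigma,n}(K)$ the subspace of $\mathcal{Z}_\Sigma(K)$ spanned by those of weight $n$. $\mathcal{Z}_\emptyset(K)=\mathcal{L}_\emptyset(K)$ is the $K$-algebra of Thakur's multiple zeta values, and $\mathcal{Z}_\Sigma(K)=\bigoplus_n\mathcal{Z}_{\Sigma,n}(K)$ and $\mathcal{L}_\Sigma(K)$ are graded (by weight) $\mathcal{Z}_\emptyset(K)$-modules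 under multiplication. For $\underline{k}=(k_i)_{i\in\Sigma}\in\mathbf{N}^{|\Sigma|}$ put $\theta^{q^{\underline{k}}}=(\theta^{q^{k_i}})_{i\in\Sigma}$. Trivial multiple zeta values: $\mathcal{Z}^{\mathrm{triv}}_{\Sigma,n}(K)$ is the set of $f\in\mathcal{Z}_{\Sigma,n}(K)$ with $f(\theta^{q^{\underline{k}}})=0$ for all but finitely many $\underline{k}\in\mathbf{N}^{|\Sigma|}$, and $\mathcal{Z}^{\mathrm{triv}}_\Sigma(K)=\bigoplus_{n\ge0}\mathcal{Z}^{\mathrm{triv}}_{\Sigma,n}(K)$, a $\mathcal{Z}_\emptyset(K)$-submodule of $\mathcal{Z}_\Sigma(K)$. The map $\mathcal{F}_\Sigma:\mathcal{Z}_\Sigma(K)\to\mathcal{L}_\Sigma(K)$ is $$\mathcal{F}_\Sigma(f)=\sum_{\underline{i}\in\mathbf{N}^{|\Sigma|}}\ \sum_{\underline{j}\le\underline{i}}\frac{f(\theta^{q^{\underline{j}}})}{D_{\underline{j}}\,\ell_{\underline{i}-\underline{j}}^{q^{\underline{j}}}}X_\Sigma^{q^{\underline{i}}},$$ where $\underline{j}\in\mathbf{N}^{|\Sigma|}$, $\le$ is componentwise, $X_\Sigma^{q^{\underline{i}}}=\prod_{r\in\Sigma}X_r^{q^{i_r}}$, $D_{\underline{j}}=\prod_{r\in\Sigma}D_{j_r}$, $\ell_{\underline{i}-\underline{j}}^{q^{\underline{j}}}=\prod_{r\in\Sigma}\ell_{i_r-j_r}^{q^{j_r}}$; it is known (Gezmis–Pellarin)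 that $\mathcal{F}_\Sigma$ is well defined and an isomorphism of graded $\mathcal{Z}_\emptyset(K)$-modules. Let $\mathrm{ev}:\mathcal{L}_\Sigma(K)\to\mathcal{Z}_\emptyset(K)$ be evaluation at $X_i=1$ for all $i\in\Sigma$, and $\mathcal{G}_\Sigma=\mathrm{ev}\circ\mathcal{F}_\Sigma|_{\mathcal{Z}^{\mathrm{triv}}_\Sigma(K)}:\mathcal{Z}^{\mathrm{triv}}_\Sigma(K)\to\mathcal{Z}_\emptyset(K)$. *)

theory Defs
  imports "HOL-Analysis.Analysis" "HOL-Computational_Algebra.Computational_Algebra"
begin

section \<open>The field of coefficients\<close>

text \<open>
  Fields with a multiplicative non-Archimedean absolute value; the absolute value of
  \<open>x\<close> is \<open>dist x 0\<close>.
\<close>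

class nonarch_field = field + metric_space +
  assumes dist_conv_0: "dist x y = dist (x - y) 0"
    and dist_mult_0: "dist (x * y) 0 = dist x 0 * dist y 0"
    and dist_add_0_le: "dist (x + y) 0 \<le> max (dist x 0) (dist y 0)"

text \<open>
  \<open>K\<^sub>\<infinity> = F\<^sub>q((1/\<theta>))\<close> is \<^typ>\<open>'q fls\<close>, where \<^const>\<open>fls_X\<close> is \<open>1/\<theta>\<close> and
  \<^const>\<open>fls_X_inv\<close> is \<open>\<theta>\<close>.  The library's metric on \<^typ>\<open>'q fls\<close> is given by the absolute
  value \<open>2 powr (- v\<^sub>\<infinity> x)\<close>; the choice of the base does not affect completions.
  The elements of \<open>'c\<close> that are algebraic over the embedded copy of \<open>K\<^sub>\<infinity>\<close>:
\<close>

definition alg_elements :: "('q::finite_field fls \<Rightarrow> 'c::field) \<Rightarrow> 'c set" where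
  "alg_elements \<iota> = {x. \<exists>p. p \<noteq> 0 \<and> poly (map_poly \<iota> p) x = 0}"

text \<open>
  \<open>'c\<close> is a completion of an algebraic closure of \<open>K\<^sub>\<infinity>\<close>, via the isometric embedding \<open>\<iota>\<close>.
  Completeness is the sort constraint \<^class>\<open>complete_space\<close>.
\<close>

definition is_C_infinity ::
  "('q::finite_field fls \<Rightarrow> 'c::{nonarch_field, complete_space}) \<Rightarrow> bool" where
  "is_C_infinity \<iota> \<longleftrightarrow>
     \<iota> 1 = 1 \<and> (\<forall>x y. \<iota> (x + y) = \<iota> x + \<iota> y) \<and> (\<forall>x y. \<iota> (x * y) = \<iota> x * \<iota> y) \<and>
     (\<forall>x y. dist (\<iota> x) (\<iota> y) = dist x y) \<and>
     (\<forall>p. degree p > 0 \<and> (\<forall>n. coeff p n \<in> alg_elements \<iota>) \<longrightarrow>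
        (\<exists>x\<in>alg_elements \<iota>. poly p x = 0)) \<and>
     closure (alg_elements \<iota>) = UNIV"

definition theta :: "('q::finite_field fls \<Rightarrow> 'c::field) \<Rightarrow> 'c" where
  "theta \<iota> = \<iota> fls_X_inv"

text \<open>
  \<open>A = F\<^sub>q[\<theta>]\<close> is \<^typ>\<open>'q poly\<close>; \<open>subst_at \<iota> a t\<close> is \<open>a(t)\<close>, and in particular
  \<open>subst_at \<iota> a (theta \<iota>)\<close> is \<open>a\<close> itself as an element of \<open>'c\<close>.
\<close>

definition subst_at :: "('q::finite_field fls \<Rightarrow> 'c::field) \<Rightarrow> 'q poly \<Rightarrow> 'c \<Rightarrow> 'c" where
  "subst_at \<iota> a t = poly (map_poly (\<lambda>c. \<iota> (fls_const c)) a) t"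

definition base_K :: "('q::finite_field fls \<Rightarrow> 'c::field) \<Rightarrow> 'c set" where
  "base_K \<iota> = {subst_at \<iota> a (theta \<iota>) / subst_at \<iota> b (theta \<iota>) | a b. b \<noteq> 0}"

definition ell :: "('q::finite_field fls \<Rightarrow> 'c::field) \<Rightarrow> nat \<Rightarrow> 'c" where
  "ell \<iota> d = (\<Prod>i=1..d. theta \<iota> - theta \<iota> ^ (CARD('q) ^ i))"

definition DD :: "('q::finite_field fls \<Rightarrow> 'c::field) \<Rightarrow> nat \<Rightarrow> 'c" where
  "DD \<iota> d = (\<Prod>i<d. theta \<iota> ^ (CARD('q) ^ d) - theta \<iota> ^ (CARD('q) ^ i))"


section \<open>Pellarin multiple zeta values\<close>

text \<open>The columns of an array are listed from left to right.\<close>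

type_synonym array = "(nat set \<times> nat) list"

definition admissible :: "nat set \<Rightarrow> array \<Rightarrow> bool" where
  "admissible \<Sigma> A \<longleftrightarrow>
     (\<forall>i<length A. \<forall>j<length A. i \<noteq> j \<longrightarrow> fst (A ! i) \<inter> fst (A ! j) = {}) \<and>
     (\<Union>i<length A. fst (A ! i)) = \<Sigma> \<and> (\<forall>i<length A. snd (A ! i) > 0)"

definition weight :: "array \<Rightarrow> nat" where
  "weight A = (\<Sum>i<length A. snd (A ! i))"

definition chi :: "('q::finite_field fls \<Rightarrow> 'c::field) \<Rightarrow> nat set \<Rightarrow> 'q poly \<Rightarrow> (nat \<Rightarrow> 'c) \<Rightarrow> 'c" where
  "chi \<iota> U a t = (\<Prod>i\<in>U. subst_at \<iota> a (t i))"

definition monic_tuples :: "nat \<Rightarrow> nat \<Rightarrow> 'q::finite_field poly list set" where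
  "monic_tuples r N =
     {as. length as = r \<and> (\<forall>a\<in>set as. lead_coeff a = 1 \<and> degree a < N) \<and>
          sorted_wrt (\<lambda>a b. degree a > degree b) as}"

text \<open>
  The value at \<open>t\<close> of the entire function \<open>\<zeta>\<^sub>A\<close>; only the \<open>t i\<close> with \<open>i\<close> in the type of the
  array matter.  The summation has to be ordered by degree: for \<open>t\<close> outside the unit
  polydisc the individual terms need not tend to 0.
\<close>

definition zeta_A ::
  "('q::finite_field fls \<Rightarrow> 'c::{nonarch_field, complete_space}) \<Rightarrow> array \<Rightarrow> (nat \<Rightarrow> 'c) \<Rightarrow> 'c" where
  "zeta_A \<iota> A t = lim (\<lambda>N. \<Sum>as\<in>monic_tuples (length A) N.
     (\<Prod>i<length A. chi \<iota> (fst (A ! i)) (as ! i) t)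
       / (\<Prod>i<length A. subst_at \<iota> (as ! i) (theta \<iota>) ^ snd (A ! i)))"

definition K_span ::
  "('q::finite_field fls \<Rightarrow> 'c::field) \<Rightarrow> ((nat \<Rightarrow> 'c) \<Rightarrow> 'c) set \<Rightarrow> ((nat \<Rightarrow> 'c) \<Rightarrow> 'c) set" where
  "K_span \<iota> B = {(\<lambda>t. \<Sum>b\<in>S. c b * b t) | S c. finite S \<and> S \<subseteq> B \<and> (\<forall>b\<in>S. c b \<in> base_K \<iota>)}"

definition Z_space ::
  "('q::finite_field fls \<Rightarrow> 'c::{nonarch_field, complete_space}) \<Rightarrow> nat set \<Rightarrow> nat
     \<Rightarrow> ((nat \<Rightarrow> 'c) \<Rightarrow> 'c) set" where
  "Z_space \<iota> \<Sigma> n = K_span \<iota> {zeta_A \<iota> A | A. admissible \<Sigma> A \<and> weight A = n}"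

text \<open>Multi-indices in \<open>N\<^bsup>|\<Sigma>|\<^esup>\<close>, indexed by \<open>\<Sigma>\<close>.\<close>

definition multi_indices :: "nat set \<Rightarrow> (nat \<Rightarrow> nat) set" where
  "multi_indices \<Sigma> = \<Sigma> \<rightarrow>\<^sub>E UNIV"

definition theta_pow ::
  "('q::finite_field fls \<Rightarrow> 'c::field) \<Rightarrow> (nat \<Rightarrow> nat) \<Rightarrow> nat \<Rightarrow> 'c" where
  "theta_pow \<iota> k = (\<lambda>r. theta \<iota> ^ (CARD('q) ^ k r))"

definition Z_triv_weight ::
  "('q::finite_field fls \<Rightarrow> 'c::{nonarch_field, complete_space}) \<Rightarrow> nat set \<Rightarrow> nat
     \<Rightarrow> ((nat \<Rightarrow> 'c) \<Rightarrow> 'c) set" where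
  "Z_triv_weight \<iota> \<Sigma> n =
     {f \<in> Z_space \<iota> \<Sigma> n. finite {k \<in> multi_indices \<Sigma>. f (theta_pow \<iota> k) \<noteq> 0}}"

definition Z_triv ::
  "('q::finite_field fls \<Rightarrow> 'c::{nonarch_field, complete_space}) \<Rightarrow> nat set
     \<Rightarrow> ((nat \<Rightarrow> 'c) \<Rightarrow> 'c) set" where
  "Z_triv \<iota> \<Sigma> = {(\<lambda>t. \<Sum>n<N. g n t) | N g. \<forall>n<N. g n \<in> Z_triv_weight \<iota> \<Sigma> n}"


section \<open>The map to power series and its evaluation\<close>

text \<open>
  A power series in the variables \<open>X\<^sub>r\<close>, \<open>r \<in> \<Sigma>\<close>, is represented by its coefficient
  function on exponents \<open>e \<in> multi_indices \<Sigma>\<close>.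
\<close>

type_synonym 'c series = "(nat \<Rightarrow> nat) \<Rightarrow> 'c"

text \<open>The exponent \<open>q\<^bsup>i\<^esup>\<close> of the monomial \<open>X\<^sub>\<Sigma>\<close> to the power \<open>q\<^bsup>i\<^esup>\<close>.\<close>

definition q_pow :: "nat \<Rightarrow> nat set \<Rightarrow> (nat \<Rightarrow> nat) \<Rightarrow> nat \<Rightarrow> nat" where
  "q_pow q \<Sigma> i = (\<lambda>r\<in>\<Sigma>. q ^ i r)"

text \<open>
  Since \<open>i \<mapsto> q\<^bsup>i\<^esup>\<close> is injective, the outer sum below, which collects the coefficient of the
  monomial with exponent \<open>e\<close>, has at most one term.
\<close>

definition F_map ::
  "('q::finite_field fls \<Rightarrow> 'c::field) \<Rightarrow> nat set \<Rightarrow> ((nat \<Rightarrow> 'c) \<Rightarrow> 'c) \<Rightarrow> 'c series" where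
  "F_map \<iota> \<Sigma> f = (\<lambda>e.
     \<Sum>i\<in>{i \<in> multi_indices \<Sigma>. q_pow CARD('q) \<Sigma> i = e}.
       \<Sum>j\<in>{j \<in> multi_indices \<Sigma>. \<forall>r\<in>\<Sigma>. j r \<le> i r}.
         f (theta_pow \<iota> j)
           / ((\<Prod>r\<in>\<Sigma>. DD \<iota> (j r)) * (\<Prod>r\<in>\<Sigma>. ell \<iota> (i r - j r) ^ (CARD('q) ^ j r))))"

definition eval_series ::
  "nat set \<Rightarrow> 'c::{nonarch_field, complete_space} series \<Rightarrow> (nat \<Rightarrow> 'c) \<Rightarrow> 'c" where
  "eval_series \<Sigma> g x = infsum (\<lambda>e. g e * (\<Prod>r\<in>\<Sigma>. x r ^ e r)) (multi_indices \<Sigma>)"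

definition ev :: "nat set \<Rightarrow> 'c::{nonarch_field, complete_space} series \<Rightarrow> 'c" where
  "ev \<Sigma> g = eval_series \<Sigma> g (\<lambda>_. 1)"

definition G_map ::
  "('q::finite_field fls \<Rightarrow> 'c::{nonarch_field, complete_space}) \<Rightarrow> nat set
     \<Rightarrow> ((nat \<Rightarrow> 'c) \<Rightarrow> 'c) \<Rightarrow> 'c" where
  "G_map \<iota> \<Sigma> = ev \<Sigma> \<circ> F_map \<iota> \<Sigma>"

end

theory Submission
  imports Defs
begin

text \<open>
  Let \<open>m = |\<Sigma>|\<close> and let \<open>L = \<Sum> 1/\<ell>\<^sub>i\<close> be the Carlitz logarithm of 1.  If a trivial multiple zeta
  value \<open>f\<close> takes the values \<open>v\<^sub>j\<close> at the points \<open>\<theta>\<^bsup>q^j\<^esup>\<close>, then the double series that defines \<open>G\<close>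
  can be summed to
    \<open>G(f) = \<Sum>\<^sub>j v\<^sub>j / D\<^sub>j \<cdot> L\<^bsup>|q^j|\<^esup>\<close>, with \<open>|q^j| = \<Sum>\<^bsub>r\<in>\<Sigma>\<^esub> q^(j r)\<close>
  (lemma \<open>G_map_finite_support\<close>).  Two kinds of multi-indices suffice to produce a relation: the zero
  multi-index, which contributes \<open>v\<^sub>0 L\<^sup>m\<close>, and the \<open>m\<close> unit multi-indices, which contribute
  \<open>v L\<^bsup>m+q-1\<^esup> / (\<theta>\<^sup>q - \<theta>)\<close> each.  It remains to find a nonzero \<open>f\<close> in the span of the zeta values of
  weight \<open>m + q - 1\<close> with the value \<open>v\<^sub>0 = - m L\<^bsup>q-1\<^esup> / (\<theta>\<^sup>q - \<theta>)\<close> at the zero multi-index, \<open>v = 1\<close> at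
  the unit multi-indices, and 0 elsewhere (lemma \<open>kernel_element\<close>).

  At \<open>\<theta>\<^bsup>q^k\<^esup>\<close> the twists \<open>a(t\<^sub>r)\<close> become powers of \<open>a\<close>, so a zeta value of depth one becomes a sum of
  powers of the monic polynomials.  Such sums vanish for positive exponents divisible by \<open>q - 1\<close>
  (lemma \<open>trivial_zeros\<close>).  Hence the zeta value of type \<open>\<Sigma>\<close> and weight \<open>m\<close> is 1 at \<open>\<theta>\<close> and 0 at the
  other twists.  The one of weight \<open>m + q - 1\<close> is \<open>\<zeta>(q - 1)\<close> at \<open>\<theta>\<close>, is 1 at the unit multi-indices,
  and is 0 at the other twists.  Subtracting from the latter the multiple of the former by
  \<open>\<zeta>(q - 1) + m L\<^bsup>q-1\<^esup> / (\<theta>\<^sup>q - \<theta>)\<close> gives \<open>f\<close>.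

  Two facts make this legitimate.  First, \<open>L\<close> is the zeta value \<open>\<zeta>(1)\<close>, by Carlitz's formula for
  the sum of the inverses of the monic polynomials of degree \<open>d\<close> (lemma \<open>sum_inverse_monics\<close>).
  Second, products of zeta values with disjoint types are \<open>K\<close>-linear combinations of zeta values
  of the total weight.  This holds already for the truncated sums (lemma \<open>trunc_span_mult\<close>),
  by partial fractions and induction on the weight.  The limit is only needed at the points
  \<open>\<theta>\<^bsup>q^k\<^esup>\<close>, where convergence is elementary.
\<close>


section \<open>Fields with a non-Archimedean absolute value\<close>

abbreviation absv :: "'c::nonarch_field \<Rightarrow> real" where
  "absv x \<equiv> dist x 0"

lemma absv_one [simp]: "absv (1::'c::nonarch_field) = 1"
proof -
  have "absv (1::'c) * absv (1::'c) = absv (1::'c)"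
    using dist_mult_0[of "1::'c" 1] by simp
  then show ?thesis
    by simp
qed

lemma absv_power: "absv (x ^ n) = absv (x::'c::nonarch_field) ^ n"
  by (induction n) (simp_all add: dist_mult_0)

lemma absv_minus [simp]: "absv (- x) = absv (x::'c::nonarch_field)"
proof -
  have "absv (-1::'c) * absv (-1::'c) = 1"
    using dist_mult_0[of "-1::'c" "-1"] by simp
  then have "absv (-1::'c) = 1"
    using zero_le_dist[of "-1::'c" 0] by (auto simp: square_eq_1_iff)
  then show ?thesis
    using dist_mult_0[of "-1" x] by simp
qed

lemma absv_divide: "absv (x / y) = absv x / absv (y::'c::nonarch_field)"
proof (cases "y = 0")
  case False
  then have "absv (x / y) * absv y = absv x"
    using dist_mult_0[of "x / y" y] by simp
  with False show ?thesis
    by (simp add: field_simps)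
qed auto

lemma absv_prod: "absv (prod f A) = (\<Prod>a\<in>A. absv (f a :: 'c::nonarch_field))"
  by (induction A rule: infinite_finite_induct) (simp_all add: dist_mult_0)

lemma absv_sum_le:
  assumes "0 \<le> B" and "\<And>a. a \<in> A \<Longrightarrow> absv (f a :: 'c::nonarch_field) \<le> B"
  shows "absv (sum f A) \<le> B"
  using assms(2)
proof (induction A rule: infinite_finite_induct)
  case (insert a A)
  then have "max (absv (f a)) (absv (sum f A)) \<le> B"
    by simp
  with insert.hyps show ?case
    using dist_add_0_le[of "f a" "sum f A"] by (simp del: max.bounded_iff)
qed (simp_all add: assms(1))

text \<open>In an ultrametric triangle the two longest sides are equal.\<close>

lemma absv_add_eq:
  assumes "absv x < absv (y::'c::nonarch_field)"
  shows "absv (x + y) = absv y"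
proof (rule antisym)
  show "absv (x + y) \<le> absv y"
    using dist_add_0_le[of x y] assms by simp
  show "absv y \<le> absv (x + y)"
    using dist_add_0_le[of "x + y" "- x"] assms by simp
qed

instance nonarch_field < topological_ab_group_add
proof
  fix a b :: 'a
  show "LIM x nhds a \<times>\<^sub>F nhds b. fst x + snd x :> nhds (a + b)"
  proof (rule tendstoI)
    fix e :: real
    assume "0 < e"
    have "\<forall>\<^sub>F x in nhds a \<times>\<^sub>F nhds b. dist (fst x) a < e"
      "\<forall>\<^sub>F x in nhds a \<times>\<^sub>F nhds b. dist (snd x) b < e"
      using tendstoD[OF filterlim_fst \<open>0 < e\<close>] tendstoD[OF filterlim_snd \<open>0 < e\<close>] by auto
    then show "\<forall>\<^sub>F x in nhds a \<times>\<^sub>F nhds b. dist (fst x + snd x) (a + b) < e"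
    proof eventually_elim
      case (elim x)
      have "fst x + snd x - (a + b) = (fst x - a) + (snd x - b)"
        by simp
      then have "dist (fst x + snd x) (a + b) = absv ((fst x - a) + (snd x - b))"
        by (metis dist_conv_0)
      also have "\<dots> \<le> max (dist (fst x) a) (dist (snd x) b)"
        using dist_add_0_le dist_conv_0 by metis
      finally show ?case
        using elim by simp
    qed
  qed
  show "(uminus \<longlongrightarrow> - a) (nhds a)"
  proof (rule tendstoI)
    fix e :: real
    assume "0 < e"
    have "dist (- x) (- a) = dist x a" for x
      using dist_conv_0[of "- x" "- a"] dist_conv_0[of a x] by (simp add: dist_commute)
    then show "\<forall>\<^sub>F x in nhds a. dist (- x) (- a) < e"
      using tendstoD[OF filterlim_ident \<open>0 < e\<close>] by simp
  qed
qed

instance nonarch_field < topological_comm_monoid_mult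
proof
  fix a b :: 'a
  show "LIM x nhds a \<times>\<^sub>F nhds b. fst x * snd x :> nhds (a * b)"
  proof (rule tendstoI)
    fix e :: real
    assume "0 < e"
    define r where "r = min 1 (e / (1 + absv a + absv b))"
    have pos: "0 < 1 + absv a + absv b"
      by (simp add: add_pos_nonneg)
    with \<open>0 < e\<close> have "0 < r"
      by (simp add: r_def)
    have r: "r * (1 + absv a + absv b) \<le> e" "r \<le> 1"
      using pos by (simp_all add: r_def pos_le_divide_eq[symmetric])
    have "\<forall>\<^sub>F x in nhds a \<times>\<^sub>F nhds b. dist (fst x) a < r"
      "\<forall>\<^sub>F x in nhds a \<times>\<^sub>F nhds b. dist (snd x) b < r"
      using tendstoD[OF filterlim_fst \<open>0 < r\<close>] tendstoD[OF filterlim_snd \<open>0 < r\<close>] by auto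
    then show "\<forall>\<^sub>F x in nhds a \<times>\<^sub>F nhds b. dist (fst x * snd x) (a * b) < e"
    proof eventually_elim
      case (elim x)
      define u v where "u = fst x - a" and "v = snd x - b"
      have u: "absv u < r" and v: "absv v < r"
        using elim dist_conv_0[of "fst x" a] dist_conv_0[of "snd x" b] by (simp_all add: u_def v_def)
      have "fst x * snd x - a * b = u * v + (u * b + a * v)"
        by (simp add: u_def v_def algebra_simps)
      then have "dist (fst x * snd x) (a * b) = absv (u * v + (u * b + a * v))"
        by (metis dist_conv_0)
      also have "\<dots> \<le> max (absv (u * v)) (max (absv (u * b)) (absv (a * v)))"
        using dist_add_0_le[of "u * v" "u * b + a * v"] dist_add_0_le[of "u * b" "a * v"] by linarith
      also have "\<dots> < e"
      proof -
        have "absv u * absv v < r * 1"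
          using u v r \<open>0 < r\<close> by (intro mult_strict_mono) auto
        moreover have "absv u * absv b \<le> r * absv b" "absv v * absv a \<le> r * absv a"
          using u v by (intro mult_right_mono; simp)+
        moreover have "0 \<le> r * absv a" "0 \<le> r * absv b"
          using \<open>0 < r\<close> by simp_all
        moreover have "r + r * absv a + r * absv b \<le> e"
          using r(1) by (simp add: algebra_simps)
        ultimately show ?thesis
          unfolding dist_mult_0 max_less_iff_conj mult.commute[of "absv a"]
          using \<open>0 < r\<close> by (intro conjI; linarith)
      qed
      finally show ?case .
    qed
  qed
qed

text \<open>
  The partial sums are Cauchy because a finite sum is no larger than its largest term.
\<close>

lemma nonarch_convergent_sum:
  fixes h :: "nat \<Rightarrow> 'c::{nonarch_field, complete_space}"
  assumes "h \<longlonglongrightarrow> 0"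
  shows "convergent (\<lambda>n. \<Sum>i<n. h i)"
proof -
  have "Cauchy (\<lambda>n. \<Sum>i<n. h i)"
  proof (rule metric_CauchyI)
    fix e :: real
    assume "0 < e"
    then have "\<forall>\<^sub>F i in sequentially. absv (h i) < e / 2"
      using tendstoD[OF assms, of "e / 2"] by simp
    then obtain M where M: "\<And>i. M \<le> i \<Longrightarrow> absv (h i) < e / 2"
      by (auto simp: eventually_sequentially)
    have ord: "dist (\<Sum>i<n. h i) (\<Sum>i<m. h i) < e" if "M \<le> m" "m \<le> n" for m n
    proof -
      have "(\<Sum>i<n. h i) - (\<Sum>i<m. h i) = (\<Sum>i\<in>{m..<n}. h i)"
        using sum_diff[of "{..<n}" "{..<m}" h] \<open>m \<le> n\<close>
        by (simp add: ivl_diff lessThan_minus_lessThan)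
      then have "dist (\<Sum>i<n. h i) (\<Sum>i<m. h i) = absv (\<Sum>i\<in>{m..<n}. h i)"
        by (metis dist_conv_0)
      also have "\<dots> \<le> e / 2"
        using M \<open>M \<le> m\<close> \<open>0 < e\<close> by (intro absv_sum_le) (auto intro: less_imp_le)
      finally show ?thesis
        using \<open>0 < e\<close> by simp
    qed
    show "\<exists>M. \<forall>m\<ge>M. \<forall>n\<ge>M. dist (\<Sum>i<m. h i) (\<Sum>i<n. h i) < e"
      using ord by (intro exI[of _ M]) (metis dist_commute linear)
  qed
  then show ?thesis
    by (rule Cauchy_convergent)
qed

text \<open>
  Unordered summation may be replaced by summation along finite sets outside of which the
  terms are uniformly small, because a finite sum of small terms is small.
\<close>

lemma nonarch_has_sum:
  fixes g :: "'i \<Rightarrow> 'c::nonarch_field"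
  assumes fin: "\<And>n. finite (B n)" and sub: "\<And>n. B n \<subseteq> I"
    and lim: "(\<lambda>n. sum g (B n)) \<longlonglongrightarrow> s"
    and small: "\<And>e. 0 < e \<Longrightarrow> \<forall>\<^sub>F n in sequentially. \<forall>i\<in>I - B n. absv (g i) < e"
  shows "(g has_sum s) I"
  unfolding has_sum_def
proof (rule tendstoI)
  fix e :: real
  assume "0 < e"
  have "\<forall>\<^sub>F n in sequentially. dist (sum g (B n)) s < e / 2 \<and> (\<forall>i\<in>I - B n. absv (g i) < e / 2)"
    using tendstoD[OF lim, of "e / 2"] small[of "e / 2"] \<open>0 < e\<close> by (simp add: eventually_conj)
  then obtain n where n: "dist (sum g (B n)) s < e / 2" "\<And>i. i \<in> I - B n \<Longrightarrow> absv (g i) < e / 2"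
    by (auto simp: eventually_sequentially)
  show "\<forall>\<^sub>F F in finite_subsets_at_top I. dist (sum g F) s < e"
    unfolding eventually_finite_subsets_at_top
  proof (intro exI[of _ "B n"] conjI allI impI)
    fix F
    assume F: "finite F \<and> B n \<subseteq> F \<and> F \<subseteq> I"
    then have "sum g F - sum g (B n) = sum g (F - B n)"
      by (simp add: sum_diff)
    then have "dist (sum g F) (sum g (B n)) = absv (sum g (F - B n))"
      by (metis dist_conv_0)
    also have "\<dots> \<le> e / 2"
      using F n(2) \<open>0 < e\<close> by (intro absv_sum_le) (auto intro!: less_imp_le)
    finally show "dist (sum g F) s < e"
      using n(1) dist_triangle[of "sum g F" s "sum g (B n)"] by linarith
  qed (use fin sub in auto)
qed

text \<open>
  Over the boxes \<open>I \<rightarrow>\<^sub>E {..<n}\<close> the sum of the products factors.  Outside a large box some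
  factor is small, and the other factors are bounded by 1.
\<close>

lemma nonarch_has_sum_prod:
  fixes u :: "'i \<Rightarrow> nat \<Rightarrow> 'c::nonarch_field"
  assumes "finite I"
    and lim: "\<And>r. r \<in> I \<Longrightarrow> (\<lambda>n. \<Sum>b<n. u r b) \<longlonglongrightarrow> s r"
    and null: "\<And>r. r \<in> I \<Longrightarrow> u r \<longlonglongrightarrow> 0"
    and bound: "\<And>r b. r \<in> I \<Longrightarrow> absv (u r b) \<le> 1"
  shows "((\<lambda>i. \<Prod>r\<in>I. u r (i r)) has_sum (\<Prod>r\<in>I. s r)) (I \<rightarrow>\<^sub>E UNIV)"
proof (rule nonarch_has_sum[where B = "\<lambda>n. I \<rightarrow>\<^sub>E {..<n}"])
  show "finite (I \<rightarrow>\<^sub>E {..<n})" for n :: nat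
    using assms(1) by (simp add: finite_PiE)
  show "I \<rightarrow>\<^sub>E {..<n} \<subseteq> I \<rightarrow>\<^sub>E UNIV" for n :: nat
    by (rule PiE_mono) simp
  have "(\<Sum>i\<in>I \<rightarrow>\<^sub>E {..<n}. \<Prod>r\<in>I. u r (i r)) = (\<Prod>r\<in>I. \<Sum>b<n. u r b)" for n
    using assms(1) by (simp add: prod_sum_PiE)
  then show "(\<lambda>n. \<Sum>i\<in>I \<rightarrow>\<^sub>E {..<n}. \<Prod>r\<in>I. u r (i r)) \<longlonglongrightarrow> (\<Prod>r\<in>I. s r)"
    by (simp add: tendsto_prod' lim)
  show "\<forall>\<^sub>F n in sequentially. \<forall>i\<in>(I \<rightarrow>\<^sub>E UNIV) - (I \<rightarrow>\<^sub>E {..<n}). absv (\<Prod>r\<in>I. u r (i r)) < e"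
    if "0 < e" for e
  proof -
    have "\<forall>\<^sub>F n in sequentially. \<forall>r\<in>I. \<forall>b\<ge>n. absv (u r b) < e"
    proof (intro eventually_ball_finite assms(1) ballI)
      fix r
      assume "r \<in> I"
      from tendstoD[OF null[OF this] \<open>0 < e\<close>]
      show "\<forall>\<^sub>F n in sequentially. \<forall>b\<ge>n. absv (u r b) < e"
        by (simp add: eventually_all_ge_at_top)
    qed
    then show ?thesis
    proof eventually_elim
      case (elim n)
      show ?case
      proof
        fix i
        assume i: "i \<in> (I \<rightarrow>\<^sub>E UNIV) - (I \<rightarrow>\<^sub>E {..<n})"
        then obtain r where r: "r \<in> I" "n \<le> i r"
          by (force simp: PiE_iff)
        have "absv (\<Prod>r\<in>I. u r (i r)) = absv (u r (i r)) * (\<Prod>r\<in>I - {r}. absv (u r (i r)))"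
          using assms(1) r(1) by (simp add: prod.remove[of I r] dist_mult_0 absv_prod)
        also have "\<dots> \<le> absv (u r (i r)) * 1"
          using bound by (intro mult_left_mono prod_le_1) auto
        also have "\<dots> < e"
          using elim r by simp
        finally show "absv (\<Prod>r\<in>I. u r (i r)) < e" .
      qed
    qed
  qed
qed

lemma has_sum_sum:
  fixes g :: "'j \<Rightarrow> 'i \<Rightarrow> 'c::topological_comm_monoid_add"
  assumes "\<And>j. j \<in> J \<Longrightarrow> (g j has_sum s j) I"
  shows "((\<lambda>i. \<Sum>j\<in>J. g j i) has_sum (\<Sum>j\<in>J. s j)) I"
  using assms by (induction J rule: infinite_finite_induct) (auto intro: has_sum_add)

section \<open>Powers in finite fields\<close>

lemma one_less_card_finite_field: "1 < CARD('q::finite_field)"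
proof -
  have "card {0, 1 :: 'q} \<le> CARD('q)"
    by (intro card_mono) auto
  then show ?thesis
    by simp
qed

text \<open>
  Fermat's little theorem makes \<open>(X + 1)\<^sup>q - X\<^sup>q - 1\<close> vanish on all of \<open>F\<^sub>q\<close>.  Its degree is
  below \<open>q\<close>, so it is the zero polynomial.
\<close>

lemma choose_card_finite_field:
  assumes "0 < k" "k < CARD('q::finite_field)"
  shows "of_nat (CARD('q) choose k) = (0::'q)"
proof -
  define n where "n = CARD('q)"
  have n: "0 < n"
    using one_less_card_finite_field[where 'q = 'q] by (simp add: n_def)
  define p :: "'q poly" where "p = (\<Sum>k\<in>{0<..<n}. monom (of_nat (n choose k)) k)"
  have coeff_p: "coeff p k = (if 0 < k \<and> k < n then of_nat (n choose k) else 0)" for k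
    by (simp add: p_def coeff_sum if_distrib sum.delta cong: if_cong)
  have root: "poly p x = 0" for x
  proof -
    have "{..n} = insert 0 (insert n {0<..<n})"
      using n by auto
    then have "(x + 1) ^ n = x ^ n + 1 + poly p x"
      using n by (subst binomial_ring) (simp add: p_def poly_sum poly_monom)
    then show ?thesis
      by (simp add: n_def finite_field_power_card_eq_same)
  qed
  have "p = 0"
  proof (rule ccontr)
    assume "p \<noteq> 0"
    have "degree p \<le> n - 1"
      by (rule degree_le) (auto simp: coeff_p)
    moreover have "n \<le> degree p"
      using card_poly_roots_bound[OF \<open>p \<noteq> 0\<close>] root by (simp add: n_def)
    ultimately show False
      using n by simp
  qed
  then show ?thesis
    using coeff_p[of k] assms by (simp add: n_def)
qed

text \<open>
  The substitution \<open>c \<mapsto> x c\<close> multiplies the sum by \<open>x\<^sup>n\<close>, and \<open>X\<^sup>n - 1\<close> has too few roots for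
  this factor to be 1 for all nonzero \<open>x\<close>.
\<close>

lemma sum_powers_finite_field:
  assumes "n < CARD('q::finite_field) - 1"
  shows "(\<Sum>c\<in>(UNIV::'q set). c ^ n) = 0"
proof (cases "n = 0")
  case True
  then show ?thesis
    using choose_card_finite_field[of 1, where 'q = 'q] one_less_card_finite_field[where 'q = 'q]
    by simp
next
  case False
  define p :: "'q poly" where "p = monom 1 n - 1"
  have "coeff p n = 1"
    using False by (simp add: p_def)
  then have "p \<noteq> 0"
    by auto
  have "degree p \<le> n"
    unfolding p_def by (intro degree_diff_le) (simp_all add: degree_monom_le)
  have "\<exists>x. x \<noteq> 0 \<and> poly p x \<noteq> 0"
  proof (rule ccontr)
    assume "\<nexists>x. x \<noteq> 0 \<and> poly p x \<noteq> 0"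
    then have "UNIV - {0} \<subseteq> {x. poly p x = 0}"
      by auto
    then have "card (UNIV - {0::'q}) \<le> card {x. poly p x = 0}"
      by (intro card_mono) auto
    then show False
      using card_poly_roots_bound[OF \<open>p \<noteq> 0\<close>] \<open>degree p \<le> n\<close> assms by (simp add: card_Diff_singleton)
  qed
  then obtain x where "x \<noteq> 0" "poly p x \<noteq> 0"
    by blast
  then have x: "x \<noteq> 0" "x ^ n \<noteq> 1"
    by (auto simp: p_def poly_monom)
  have "(\<Sum>c\<in>(UNIV::'q set). c ^ n) = (\<Sum>c\<in>UNIV. (x * c) ^ n)"
    by (rule sum.reindex_bij_witness[of _ "\<lambda>c. x * c" "\<lambda>c. c / x"]) (use x in auto)
  also have "\<dots> = x ^ n * (\<Sum>c\<in>UNIV. c ^ n)"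
    by (simp add: power_mult_distrib sum_distrib_left)
  finally show ?thesis
    using x by simp
qed


section \<open>Arrays\<close>

lemma admissible_Nil [simp]: "admissible \<Sigma> [] \<longleftrightarrow> \<Sigma> = {}"
  by (auto simp: admissible_def)

lemma admissible_Cons:
  "admissible \<Sigma> (y # A) \<longleftrightarrow> fst y \<subseteq> \<Sigma> \<and> 0 < snd y \<and> admissible (\<Sigma> - fst y) A"
proof -
  define B where "B = (\<Union>i<length A. fst (A ! i))"
  define disj where
    "disj \<longleftrightarrow> (\<forall>i<length A. \<forall>j<length A. i \<noteq> j \<longrightarrow> fst (A ! i) \<inter> fst (A ! j) = {})"
  define pos where "pos \<longleftrightarrow> (\<forall>i<length A. 0 < snd (A ! i))"
  have "(\<Union>i<length (y # A). fst ((y # A) ! i)) = fst y \<union> B"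
    by (auto simp: B_def nth_Cons less_Suc_eq_0_disj split: nat.splits)
  moreover have "(\<forall>i<length (y # A). \<forall>j<length (y # A). i \<noteq> j \<longrightarrow> fst ((y # A) ! i) \<inter> fst ((y # A) ! j) = {})
    \<longleftrightarrow> fst y \<inter> B = {} \<and> disj"
  proof -
    have "fst y \<inter> B = {} \<longleftrightarrow> (\<forall>i<length A. fst y \<inter> fst (A ! i) = {})"
      by (auto simp: B_def)
    then show ?thesis
      by (simp add: disj_def All_less_Suc2 Int_commute[of _ "fst y"])
        (simp add: imp_conjR all_conj_distrib)
  qed
  moreover have "(\<forall>i<length (y # A). snd ((y # A) ! i) > 0) \<longleftrightarrow> 0 < snd y \<and> pos"
    by (simp add: pos_def All_less_Suc2)
  ultimately have "admissible \<Sigma> (y # A)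
      \<longleftrightarrow> (fst y \<inter> B = {} \<and> disj) \<and> fst y \<union> B = \<Sigma> \<and> 0 < snd y \<and> pos"
    unfolding admissible_def by (simp only:)
  moreover have "admissible (\<Sigma> - fst y) A \<longleftrightarrow> disj \<and> B = \<Sigma> - fst y \<and> pos"
    by (simp only: admissible_def B_def disj_def pos_def)
  moreover have "fst y \<inter> B = {} \<and> fst y \<union> B = \<Sigma> \<longleftrightarrow> fst y \<subseteq> \<Sigma> \<and> B = \<Sigma> - fst y"
    by auto
  ultimately show ?thesis
    by metis
qed

lemma weight_Nil [simp]: "weight [] = 0"
  by (simp add: weight_def)

lemma weight_Cons [simp]: "weight (y # A) = snd y + weight A"
  by (simp add: weight_def sum.lessThan_Suc_shift del: sum.lessThan_Suc)


section \<open>Polynomials as elements of the field of coefficients\<close>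

text \<open>
  The cardinality of the finite field is made a parameter so that it can be denoted by a letter.
\<close>

locale carlitz =
  fixes \<iota> :: "'q::finite_field fls \<Rightarrow> 'c::{nonarch_field, complete_space}"
    and q :: nat
  assumes C_infinity: "is_C_infinity \<iota>"
    and q_def: "q = CARD('q)"
begin

abbreviation \<theta> :: 'c where "\<theta> \<equiv> theta \<iota>"

definition const :: "'q \<Rightarrow> 'c" where
  "const c = \<iota> (fls_const c)"

definition val :: "'q poly \<Rightarrow> 'c" where
  "val a = subst_at \<iota> a \<theta>"

lemma q_gt_1: "1 < q"
  unfolding q_def by (rule one_less_card_finite_field)

lemma \<iota>_add: "\<iota> (x + y) = \<iota> x + \<iota> y" and \<iota>_mult: "\<iota> (x * y) = \<iota> x * \<iota> y"
  and \<iota>_1: "\<iota> 1 = 1" and dist_\<iota>: "dist (\<iota> x) (\<iota> y) = dist x y"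
  using C_infinity by (auto simp: is_C_infinity_def)

lemma \<iota>_0: "\<iota> 0 = 0"
  using \<iota>_add[of 0 0] by (metis add_cancel_left_right add_0)

lemma const_add: "const (c + d) = const c + const d"
  by (simp add: const_def \<iota>_add flip: fls_plus_const)

lemma const_mult: "const (c * d) = const c * const d"
  by (simp add: const_def \<iota>_mult flip: fls_const_mult_const)

lemma const_0 [simp]: "const 0 = 0" and const_1 [simp]: "const 1 = 1"
  by (simp_all add: const_def \<iota>_0 \<iota>_1)

lemma const_power: "const (c ^ n) = const c ^ n"
  by (induction n) (simp_all add: const_mult)

lemma const_sum: "const (sum f A) = (\<Sum>a\<in>A. const (f a))"
  by (induction A rule: infinite_finite_induct) (simp_all add: const_add)

lemma const_of_nat: "const (of_nat n) = of_nat n"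
  by (induction n) (simp_all add: const_add)

lemma choose_q:
  assumes "0 < k" "k < q"
  shows "of_nat (q choose k) = (0::'c)"
proof -
  have "of_nat (q choose k) = (0::'q)"
    using choose_card_finite_field assms by (simp add: q_def)
  then have "const (of_nat (q choose k)) = 0"
    by simp
  then show ?thesis
    by (simp add: const_of_nat)
qed

lemma of_nat_q: "of_nat q = (0::'c)"
  using choose_q[of 1] q_gt_1 by simp

lemma sum_const_powers: "n < q - 1 \<Longrightarrow> (\<Sum>c\<in>UNIV. const c ^ n) = 0"
  using sum_powers_finite_field[of n, where 'q = 'q] by (simp add: q_def flip: const_power const_sum)

lemma absv_const: "c \<noteq> 0 \<Longrightarrow> absv (const c) = 1"
  using dist_\<iota>[of "fls_const c" 0] by (simp add: const_def \<iota>_0 dist_fls_def)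

lemma const_eq_0_iff [simp]: "const c = 0 \<longleftrightarrow> c = 0"
  using absv_const[of c] by (cases "c = 0") auto

lemma const_power_q: "const c ^ q = const c"
  by (simp add: q_def finite_field_power_card_eq_same flip: const_power)

lemma absv_theta: "absv \<theta> = 2"
  using dist_\<iota>[of fls_X_inv 0] by (simp add: theta_def \<iota>_0 dist_fls_def)

lemma inj_theta_power: "\<theta> ^ m = \<theta> ^ n \<longleftrightarrow> m = n"
proof
  assume "\<theta> ^ m = \<theta> ^ n"
  then have "absv (\<theta> ^ m) = absv (\<theta> ^ n)"
    by simp
  then show "m = n"
    by (simp add: absv_power absv_theta)
qed simp

lemma subst_at_0 [simp]: "subst_at \<iota> 0 t = 0"
  by (simp add: subst_at_def)

lemma subst_at_pCons: "subst_at \<iota> (pCons c a) t = const c + t * subst_at \<iota> a t"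
  by (cases "c = 0 \<and> a = 0") (auto simp: subst_at_def const_def map_poly_pCons \<iota>_0)

lemma subst_at_1 [simp]: "subst_at \<iota> 1 t = 1"
  unfolding one_pCons by (simp add: subst_at_pCons)

lemma subst_at_add: "subst_at \<iota> (a + b) t = subst_at \<iota> a t + subst_at \<iota> b t"
proof (induction a arbitrary: b)
  case (pCons c a)
  obtain d b' where "b = pCons d b'"
    by (cases b)
  then show ?case
    by (simp add: subst_at_pCons const_add pCons.IH[of b'] distrib_left)
qed simp

lemma subst_at_smult: "subst_at \<iota> (smult c a) t = const c * subst_at \<iota> a t"
  by (induction a) (simp_all add: subst_at_pCons const_mult algebra_simps)

lemma subst_at_mult: "subst_at \<iota> (a * b) t = subst_at \<iota> a t * subst_at \<iota> b t"
  by (induction a) (simp_all add: subst_at_pCons subst_at_add subst_at_smult algebra_simps)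

lemma subst_at_diff: "subst_at \<iota> (a - b) t = subst_at \<iota> a t - subst_at \<iota> b t"
  using subst_at_add[of "a - b" b t] by simp

lemma val_1 [simp]: "val 1 = 1" and val_0 [simp]: "val 0 = 0"
  by (simp_all add: val_def)

lemma val_add: "val (a + b) = val a + val b" and val_diff: "val (a - b) = val a - val b"
  and val_smult: "val (smult c a) = const c * val a" and val_mult: "val (a * b) = val a * val b"
  by (simp_all add: val_def subst_at_add subst_at_diff subst_at_smult subst_at_mult)

text \<open>
  The leading term dominates; hence \<open>\<theta>\<close> is transcendental over \<open>F\<^sub>q\<close> and quotients of values
  behave like quotients of polynomials.
\<close>

lemma absv_val: "a \<noteq> 0 \<Longrightarrow> absv (val a) = 2 ^ degree a"
proof (induction a)
  case (pCons c a)
  show ?case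
  proof (cases "a = 0")
    case True
    with pCons show ?thesis
      by (simp add: val_def subst_at_pCons absv_const)
  next
    case False
    with pCons have *: "absv (\<theta> * val a) = 2 ^ degree (pCons c a)"
      by (simp add: dist_mult_0 absv_theta)
    have "absv (const c) \<le> 1"
      by (cases "c = 0") (simp_all add: absv_const)
    also have "1 < (2::real) ^ Suc (degree a)"
      by (rule one_less_power) simp_all
    also have "\<dots> = absv (\<theta> * val a)"
      using * False by simp
    finally have "absv (const c + \<theta> * val a) = absv (\<theta> * val a)"
      by (rule absv_add_eq)
    then show ?thesis
      using * by (simp add: val_def subst_at_pCons)
  qed
qed simp

lemma val_eq_0_iff [simp]: "val a = 0 \<longleftrightarrow> a = 0"
  using absv_val[of a] by (cases "a = 0") auto

text \<open>
  The binomial coefficients vanish in \<open>F\<^sub>q\<close>, hence in every field containing it.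
\<close>

lemma frobenius_add: "(x + y) ^ (q ^ i) = x ^ (q ^ i) + (y::'c) ^ (q ^ i)"
proof (induction i arbitrary: x y)
  case (Suc i)
  have 1: "(u + v) ^ q = u ^ q + v ^ q" for u v :: 'c
  proof -
    have "{..q} = insert 0 (insert q {0<..<q})"
      using q_gt_1 by auto
    then show ?thesis
      using q_gt_1 by (subst binomial_ring) (simp add: choose_q)
  qed
  show ?case
    by (simp add: power_mult 1 Suc)
qed simp

lemma frobenius_sum: "(sum f A :: 'c) ^ (q ^ i) = (\<Sum>a\<in>A. f a ^ (q ^ i))"
  using q_gt_1
  by (induction A rule: infinite_finite_induct) (simp_all add: frobenius_add power_0_left)

text \<open>
  Polynomials over \<open>F\<^sub>q\<close> commute with the \<open>q\<close>-power Frobenius.  This turns the twists \<open>a(t\<^sub>r)\<close>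
  at \<open>t\<^sub>r = \<theta>\<^bsup>q^i\<^esup>\<close> into powers of \<open>a\<close>, and multiple zeta values into sums of powers.
\<close>

lemma subst_at_theta_power: "subst_at \<iota> a (\<theta> ^ (q ^ i)) = val a ^ (q ^ i)"
proof (induction a)
  case 0
  then show ?case
    using q_gt_1 by (simp add: power_0_left)
next
  case (pCons c a)
  have "const c ^ (q ^ i) = const c"
    by (induction i) (simp_all add: power_mult const_power_q)
  then show ?case
    using pCons by (simp add: val_def subst_at_pCons frobenius_add power_mult_distrib)
qed


section \<open>Power sums over polynomials of bounded degree\<close>

definition low :: "nat \<Rightarrow> 'q poly set" where
  "low d = {a. \<forall>i\<ge>d. coeff a i = 0}"

definition monics :: "nat \<Rightarrow> 'q poly set" where
  "monics d = {a. lead_coeff a = 1 \<and> degree a = d}"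

lemma low_0: "low 0 = {0}"
  by (auto simp: low_def poly_eq_iff)

lemma zero_in_low [simp]: "0 \<in> low d"
  by (simp add: low_def)

lemma bij_betw_low_Suc: "bij_betw (\<lambda>(c, a). monom c d + a) (UNIV \<times> low d) (low (Suc d))"
proof (rule bij_betw_byWitness[where f' = "\<lambda>a. (coeff a d, a - monom (coeff a d) d)"])
  show "(\<lambda>a. (coeff a d, a - monom (coeff a d) d)) ` low (Suc d) \<subseteq> UNIV \<times> low d"
    by (auto simp: low_def Suc_le_eq)
  show "(\<lambda>(c, a). monom c d + a) ` (UNIV \<times> low d) \<subseteq> low (Suc d)"
    by (auto simp: low_def)
  show "\<forall>x\<in>UNIV \<times> low d. (\<lambda>a. (coeff a d, a - monom (coeff a d) d)) ((\<lambda>(c, a). monom c d + a) x) = x"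
    by (auto simp: low_def)
qed auto

lemma bij_betw_monics: "bij_betw (\<lambda>a. monom 1 d + a) (low d) (monics d)"
proof (rule bij_betw_byWitness[where f' = "\<lambda>a. a - monom 1 d"])
  show "(\<lambda>a. monom 1 d + a) ` low d \<subseteq> monics d"
  proof safe
    fix a
    assume "a \<in> low d"
    then have co: "coeff (monom 1 d + a) i = (if i = d then 1 else 0)" if "d \<le> i" for i
      using that by (auto simp: low_def)
    have "degree (monom 1 d + a) = d"
      by (rule antisym) (auto intro!: degree_le le_degree simp: co simp del: coeff_add)
    then show "monom 1 d + a \<in> monics d"
      by (simp add: monics_def co del: coeff_add)
  qed
  show "(\<lambda>a. a - monom 1 d) ` monics d \<subseteq> low d"
    by (auto simp: monics_def low_def coeff_eq_0 le_less)
qed auto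

lemma finite_low [simp]: "finite (low d)"
proof (induction d)
  case (Suc d)
  then show ?case
    using bij_betw_finite[OF bij_betw_low_Suc[of d]] by simp
qed (simp add: low_0)

lemma finite_monics [simp]: "finite (monics d)"
  using bij_betw_finite[OF bij_betw_monics[of d]] by simp

lemma monics_nonzero: "a \<in> monics d \<Longrightarrow> a \<noteq> 0"
  by (auto simp: monics_def)

lemma monics_disjoint: "d \<noteq> e \<Longrightarrow> monics d \<inter> monics e = {}"
  by (auto simp: monics_def)

lemma monics_0: "monics 0 = {1}"
proof -
  have "monics 0 = (\<lambda>a. monom 1 0 + a) ` {0}"
    using bij_betw_imp_surj_on[OF bij_betw_monics[of 0]] by (simp add: low_0)
  then show ?thesis
    by (simp add: monom_0 one_pCons)
qed

lemma sum_low_Suc: "(\<Sum>a\<in>low (Suc d). g a) = (\<Sum>c\<in>UNIV. \<Sum>a\<in>low d. g (monom c d + a))"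
  using sum.reindex_bij_betw[OF bij_betw_low_Suc[of d], of g]
  by (simp add: sum.cartesian_product case_prod_unfold)

lemma sum_monics: "(\<Sum>a\<in>monics d. g a) = (\<Sum>a\<in>low d. g (monom 1 d + a))"
  using sum.reindex_bij_betw[OF bij_betw_monics[of d], of g] by simp

text \<open>Every nonzero polynomial of degree below \<open>d\<close> is a constant times a monic one.\<close>

lemma sum_low_by_monics:
  fixes g :: "'q poly \<Rightarrow> 'd::comm_monoid_add"
  shows "(\<Sum>a\<in>low d - {0}. g a) = (\<Sum>c\<in>UNIV - {0}. \<Sum>e<d. \<Sum>a\<in>monics e. g (smult c a))"
proof -
  have "bij_betw (\<lambda>(c, a). smult c a) ((UNIV - {0}) \<times> (\<Union>e<d. monics e)) (low d - {0})"
  proof (rule bij_betw_byWitness[where f' = "\<lambda>a. (lead_coeff a, smult (inverse (lead_coeff a)) a)"])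
    show "(\<lambda>(c, a). smult c a) ` ((UNIV - {0}) \<times> (\<Union>e<d. monics e)) \<subseteq> low d - {0}"
      by (auto simp: low_def monics_def coeff_eq_0)
    show "(\<lambda>a. (lead_coeff a, smult (inverse (lead_coeff a)) a)) ` (low d - {0})
        \<subseteq> (UNIV - {0}) \<times> (\<Union>e<d. monics e)"
      by (auto simp: low_def monics_def) (metis leading_coeff_0_iff not_le_imp_less)
  qed (auto simp: monics_def)
  then have "(\<Sum>a\<in>low d - {0}. g a)
      = (\<Sum>(c, a)\<in>(UNIV - {0}) \<times> (\<Union>e<d. monics e). g (smult c a))"
    by (simp add: sum.reindex_bij_betw[symmetric] case_prod_unfold)
  also have "\<dots> = (\<Sum>c\<in>UNIV - {0}. \<Sum>a\<in>(\<Union>e<d. monics e). g (smult c a))"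
    by (simp add: sum.cartesian_product)
  also have "\<dots> = (\<Sum>c\<in>UNIV - {0}. \<Sum>e<d. \<Sum>a\<in>monics e. g (smult c a))"
    by (intro sum.cong refl sum.UNION_disjoint) (auto simp: monics_disjoint)
  finally show ?thesis .
qed

text \<open>
  Expand the product in each coordinate \<open>c\<close> of \<open>a\<close>: after summation only the powers of \<open>c\<close>
  with exponent at least \<open>q - 1\<close> survive, so each of the \<open>d\<close> coordinates uses up
  \<open>q - 1\<close> of the factors.
\<close>

lemma sum_prod_affine_forms_low:
  fixes L :: "'j \<Rightarrow> 'q poly \<Rightarrow> 'c"
  assumes "finite J" "card J < d * (q - 1)"
    and add: "\<And>j a b. L j (a + b) = L j a + L j b"
    and smult: "\<And>j c a. L j (smult c a) = const c * L j a"
  shows "(\<Sum>a\<in>low d. \<Prod>j\<in>J. x j + L j a) = 0"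
  using assms(1,2)
proof (induction d arbitrary: J)
  case (Suc d)
  define y where "y j = L j (monom 1 d)" for j
  have L_monom: "L j (monom c d) = const c * y j" for j c
    using smult[of j c "monom 1 d"] by (simp add: y_def smult_monom)
  have inner: "(\<Sum>c\<in>UNIV. \<Sum>a\<in>low d. (\<Prod>j\<in>I. x j + L j a) * (\<Prod>j\<in>J - I. const c * y j)) = 0"
    (is "?S = 0") if "I \<subseteq> J" for I
  proof -
    have "(\<Sum>a\<in>low d. (\<Prod>j\<in>I. x j + L j a) * (\<Prod>j\<in>J - I. const c * y j))
        = const c ^ card (J - I) * ((\<Sum>a\<in>low d. \<Prod>j\<in>I. x j + L j a) * (\<Prod>j\<in>J - I. y j))" for c
      by (simp add: prod.distrib sum_distrib_left sum_distrib_right mult_ac)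
    then have "?S = (\<Sum>c\<in>UNIV. const c ^ card (J - I))
        * ((\<Sum>a\<in>low d. \<Prod>j\<in>I. x j + L j a) * (\<Prod>j\<in>J - I. y j))"
      by (simp add: sum_distrib_right)
    moreover have "(\<Sum>c\<in>UNIV. const c ^ card (J - I)) = 0" if "card (J - I) < q - 1"
      using that by (rule sum_const_powers)
    moreover have "(\<Sum>a\<in>low d. \<Prod>j\<in>I. x j + L j a) = 0" if "\<not> card (J - I) < q - 1"
    proof (rule Suc.IH)
      show "finite I"
        using \<open>I \<subseteq> J\<close> Suc.prems finite_subset by blast
      then have "card J = card I + card (J - I)"
        using \<open>I \<subseteq> J\<close> Suc.prems by (simp add: card_Diff_subset card_mono)
      then show "card I < d * (q - 1)"
        using Suc.prems that by simp
    qed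
    ultimately show ?thesis
      by (cases "card (J - I) < q - 1") auto
  qed
  have "(\<Sum>a\<in>low (Suc d). \<Prod>j\<in>J. x j + L j a)
      = (\<Sum>c\<in>UNIV. \<Sum>a\<in>low d. \<Prod>j\<in>J. (x j + L j a) + const c * y j)"
    by (simp add: sum_low_Suc add L_monom add_ac)
  also have "\<dots> = (\<Sum>c\<in>UNIV. \<Sum>a\<in>low d. \<Sum>I\<in>Pow J.
      (\<Prod>j\<in>I. x j + L j a) * (\<Prod>j\<in>J - I. const c * y j))"
    using Suc.prems by (simp add: prod_add)
  also have "\<dots> = (\<Sum>c\<in>UNIV. \<Sum>I\<in>Pow J. \<Sum>a\<in>low d.
      (\<Prod>j\<in>I. x j + L j a) * (\<Prod>j\<in>J - I. const c * y j))"
    by (intro sum.cong refl sum.swap)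
  also have "\<dots> = (\<Sum>I\<in>Pow J. \<Sum>c\<in>UNIV. \<Sum>a\<in>low d.
      (\<Prod>j\<in>I. x j + L j a) * (\<Prod>j\<in>J - I. const c * y j))"
    by (rule sum.swap)
  also have "\<dots> = 0"
    using inner by simp
  finally show ?case .
qed simp

lemma sum_prod_linear_forms_monics:
  fixes L :: "'j \<Rightarrow> 'q poly \<Rightarrow> 'c"
  assumes "finite J" "card J < d * (q - 1)"
    and "\<And>j a b. L j (a + b) = L j a + L j b"
    and "\<And>j c a. L j (smult c a) = const c * L j a"
  shows "(\<Sum>a\<in>monics d. \<Prod>j\<in>J. L j a) = 0"
  using sum_prod_affine_forms_low[where L = L and x = "\<lambda>j. L j (monom 1 d)", OF assms]
  by (simp add: sum_monics assms(3))

lemma sum_powers_low: "N < d * (q - 1) \<Longrightarrow> (\<Sum>a\<in>low d. val a ^ N) = 0"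
  using sum_prod_affine_forms_low[of "{..<N}" d "\<lambda>_. val" "\<lambda>_. 0"]
  by (simp add: val_add val_smult)

lemma sum_powers_monics: "N < d * (q - 1) \<Longrightarrow> (\<Sum>a\<in>monics d. val a ^ N) = 0"
  using sum_prod_linear_forms_monics[of "{..<N}" d "\<lambda>_. val"]
  by (simp add: val_add val_smult)

lemma sum_q_powers: "(\<Sum>j<i. q ^ j * (q - 1)) = q ^ i - 1"
proof (induction i)
  case (Suc i)
  have "1 \<le> q ^ i"
    using q_gt_1 by simp
  with Suc q_gt_1 show ?case
    by (simp add: diff_mult_distrib2 mult.commute)
qed simp

lemma q_minus_1_dvd: "(q - 1) dvd (q ^ i - 1)"
  unfolding sum_q_powers[symmetric] by (intro dvd_sum dvd_triv_right)

text \<open>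
  Since \<open>q\<^sup>i - 1 = (q - 1)(1 + q + \<dots> + q\<^bsup>i-1\<^esup>)\<close>, the power \<open>a\<^bsup>q^i-1\<^esup>\<close> is a product of only
  \<open>i(q - 1)\<close> linear forms, the Frobenius powers \<open>a \<mapsto> a\<^bsup>q^j\<^esup>\<close>.
\<close>

lemma prod_frobenius_eq_power:
  "(\<Prod>j\<in>{..<i} \<times> {..<q - 1}. val a ^ (q ^ fst j)) = val a ^ (q ^ i - 1)"
proof -
  have "(\<Prod>j\<in>{..<i} \<times> {..<q - 1}. val a ^ (q ^ fst j)) = (\<Prod>j<i. \<Prod>l<q - 1. val a ^ (q ^ j))"
    by (simp only: prod.cartesian_product case_prod_unfold)
  also have "\<dots> = val a ^ (\<Sum>j<i. q ^ j * (q - 1))"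
    by (simp add: power_sum power_mult)
  finally show ?thesis
    by (simp only: sum_q_powers)
qed

lemma frobenius_linear:
  "val (a + b) ^ (q ^ i) = val a ^ (q ^ i) + val b ^ (q ^ i)"
  "val (smult c a) ^ (q ^ i) = const c * val a ^ (q ^ i)"
proof -
  have "const c ^ (q ^ i) = const c"
    by (induction i) (simp_all add: power_mult const_power_q)
  then show "val (smult c a) ^ (q ^ i) = const c * val a ^ (q ^ i)"
    by (simp add: val_smult power_mult_distrib)
qed (simp add: val_add frobenius_add)

lemma sum_q_powers_low:
  assumes "i < d"
  shows "(\<Sum>a\<in>low d. val a ^ (q ^ i - 1)) = 0"
  using sum_prod_affine_forms_low[of "{..<i} \<times> {..<q - 1}" d
      "\<lambda>j a. val a ^ (q ^ fst j)" "\<lambda>_. 0"] assms q_gt_1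
  by (simp add: frobenius_linear prod_frobenius_eq_power[unfolded One_nat_def])

lemma sum_q_powers_monics:
  assumes "i < d"
  shows "(\<Sum>a\<in>monics d. val a ^ (q ^ i - 1)) = 0"
  using sum_prod_linear_forms_monics[of "{..<i} \<times> {..<q - 1}" d
      "\<lambda>j a. val a ^ (q ^ fst j)"] assms q_gt_1
  by (simp add: frobenius_linear prod_frobenius_eq_power[unfolded One_nat_def])

text \<open>
  A nonzero polynomial is a constant \<open>c\<close> times a monic one.  If \<open>q - 1\<close> divides \<open>N\<close>, then
  \<open>c\<^sup>N = 1\<close>, so the \<open>q - 1\<close> constants together contribute the factor \<open>-1\<close>.
\<close>

lemma sum_powers_monics_upto:
  assumes "(q - 1) dvd N" "0 < N"
  shows "(\<Sum>e<d. \<Sum>a\<in>monics e. val a ^ N) = - (\<Sum>a\<in>low d. val a ^ N)"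
proof -
  have one: "const c ^ N = 1" if "c \<noteq> 0" for c
  proof -
    have "c * c ^ (q - 1) = c"
      using q_gt_1 finite_field_power_card_eq_same[of c] by (simp add: q_def flip: power_Suc)
    with that have "c ^ (q - 1) = 1"
      by simp
    with assms(1) have "c ^ N = 1"
      by (auto simp: power_mult)
    then show ?thesis
      by (simp flip: const_power)
  qed
  have card: "of_nat (card (UNIV - {0::'q})) = (-1::'c)"
    using q_gt_1 of_nat_q by (simp add: card_Diff_singleton of_nat_diff flip: q_def)
  have "(\<Sum>a\<in>low d. val a ^ N) = (\<Sum>a\<in>low d - {0}. val a ^ N)"
    using assms(2) by (intro sum.mono_neutral_right) auto
  also have "\<dots> = (\<Sum>c\<in>UNIV - {0::'q}. \<Sum>e<d. \<Sum>a\<in>monics e. val a ^ N)"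
    by (simp add: sum_low_by_monics val_smult power_mult_distrib one)
  also have "\<dots> = - (\<Sum>e<d. \<Sum>a\<in>monics e. val a ^ N)"
    by (simp only: sum_constant card) simp
  finally show ?thesis
    by simp
qed

text \<open>
  These are the trivial zeros of the Carlitz zeta function, at the integers \<open>- N\<close>.
\<close>

lemma trivial_zeros:
  assumes "(q - 1) dvd N" "0 < N" "N < d * (q - 1)"
  shows "(\<Sum>e<d. \<Sum>a\<in>monics e. val a ^ N) = 0"
  using sum_powers_monics_upto[OF assms(1,2), of d] sum_powers_low[OF assms(3)] by simp


section \<open>The power sums of exponent one\<close>

lemma ell_0 [simp]: "ell \<iota> 0 = 1"
  by (simp add: ell_def)

lemma ell_Suc: "ell \<iota> (Suc n) = ell \<iota> n * (\<theta> - \<theta> ^ (q ^ Suc n))"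
  by (simp add: ell_def q_def prod.nat_ivl_Suc')

lemma theta_diff_nonzero: "0 < i \<Longrightarrow> \<theta> - \<theta> ^ (q ^ i) \<noteq> 0"
proof -
  assume "0 < i"
  then have "1 < q ^ i"
    using q_gt_1 by (intro one_less_power)
  then show ?thesis
    using inj_theta_power[of 1 "q ^ i"] by auto
qed

lemma ell_nonzero [simp]: "ell \<iota> n \<noteq> 0"
  using theta_diff_nonzero by (induction n) (auto simp: ell_Suc simp del: power_Suc)

lemma DD_0 [simp]: "DD \<iota> 0 = 1"
  by (simp add: DD_def)

lemma DD_1: "DD \<iota> 1 = \<theta> ^ q - \<theta>"
  by (simp add: DD_def q_def)

text \<open>
  The Newton interpolation series at the nodes \<open>\<theta>\<^bsup>q^i\<^esup>\<close> with coefficients \<open>1/\<ell>\<^sub>e\<close> telescopes.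
\<close>

lemma sum_newton_basis:
  "(\<Sum>e\<le>n. (\<Prod>i<e. t - \<theta> ^ (q ^ i)) / ell \<iota> e) = (\<Prod>i<n. t - \<theta> ^ (q ^ Suc i)) / ell \<iota> n"
proof (induction n)
  case (Suc n)
  define P where "P = (\<Prod>i<n. t - \<theta> ^ (q ^ Suc i))"
  define y where "y = \<theta> - \<theta> ^ (q ^ Suc n)"
  have y: "y \<noteq> 0"
    unfolding y_def by (rule theta_diff_nonzero) simp
  have "(\<Sum>e\<le>Suc n. (\<Prod>i<e. t - \<theta> ^ (q ^ i)) / ell \<iota> e)
      = P / ell \<iota> n + (t - \<theta>) * P / (ell \<iota> n * y)"
    unfolding P_def y_def
    by (simp add: Suc.IH ell_Suc prod.lessThan_Suc_shift del: power_Suc prod.lessThan_Suc)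
  also have "\<dots> = P * (t - \<theta> ^ (q ^ Suc n)) / (ell \<iota> n * y)"
    using y by (simp add: y_def field_simps)
  finally show ?case
    by (simp add: P_def y_def ell_Suc del: power_Suc)
qed simp

text \<open>
  As a polynomial in \<open>t\<close> the left-hand side has degree at most \<open>d\<close>, and it vanishes at
  \<open>\<theta>\<^bsup>q^i\<^esup>\<close> for \<open>i < d\<close> because there the sum is one of the vanishing power sums.
\<close>

lemma twisted_sum_factorization:
  "(\<Sum>a\<in>monics d. subst_at \<iota> a t / val a)
    = (\<Sum>a\<in>monics d. 1 / val a) * (\<Prod>i<d. t - \<theta> ^ (q ^ i))"
proof -
  define p where "p a = map_poly const a" for a
  have p: "subst_at \<iota> a t = poly (p a) t" for a t
    by (simp add: subst_at_def p_def const_def[abs_def])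
  define w where "w = (\<Sum>a\<in>monics d. 1 / val a)"
  define P where "P = (\<Sum>a\<in>monics d. smult (1 / val a) (p a))"
  define R where "R = P - smult w (\<Prod>i<d. [:- (\<theta> ^ (q ^ i)), 1:])"
  have poly_P: "poly P t = (\<Sum>a\<in>monics d. subst_at \<iota> a t / val a)" for t
    by (simp add: P_def poly_sum p)
  have poly_R: "poly R t = poly P t - w * (\<Prod>i<d. t - \<theta> ^ (q ^ i))" for t
    by (simp add: R_def poly_prod)
  have deg_prod: "degree (\<Prod>i<n. [:- (\<theta> ^ (q ^ i)), 1:]) = n"
    and lead_prod: "coeff (\<Prod>i<n. [:- (\<theta> ^ (q ^ i)), 1:]) n = 1" for n
  proof -
    show "degree (\<Prod>i<n. [:- (\<theta> ^ (q ^ i)), 1:]) = n"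
      by (subst degree_prod_eq_sum_degree) auto
    then show "coeff (\<Prod>i<n. [:- (\<theta> ^ (q ^ i)), 1:]) n = 1"
      using lead_coeff_prod[of "\<lambda>i. [:- (\<theta> ^ (q ^ i)), 1:]" "{..<n}"] by simp
  qed
  have "degree (smult (1 / val a) (p a)) \<le> d" if "a \<in> monics d" for a
  proof -
    have "degree (p a) \<le> degree a"
      unfolding p_def by (rule degree_le) (simp add: coeff_map_poly coeff_eq_0)
    with that show ?thesis
      by (auto simp: monics_def intro: order_trans[OF degree_smult_le])
  qed
  then have "degree P \<le> d"
    unfolding P_def by (intro degree_sum_le) auto
  then have "degree R \<le> d"
    unfolding R_def
    by (intro degree_diff_le) (auto intro: order_trans[OF degree_smult_le] simp: deg_prod)
  have "coeff P d = w"
  proof -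
    have "coeff (p a) d = 1" if "a \<in> monics d" for a
      using that by (auto simp: p_def coeff_map_poly monics_def)
    then show ?thesis
      by (simp add: P_def w_def coeff_sum)
  qed
  then have "coeff R d = 0"
    by (simp add: R_def lead_prod)
  have "R = 0"
  proof (rule ccontr)
    assume "R \<noteq> 0"
    then have "degree R < d"
      using \<open>degree R \<le> d\<close> \<open>coeff R d = 0\<close> by (metis le_neq_implies_less leading_coeff_0_iff)
    have "(\<lambda>i. \<theta> ^ (q ^ i)) ` {..<d} \<subseteq> {x. poly R x = 0}"
    proof safe
      fix i
      assume "i < d"
      have "val a ^ (q ^ i) / val a = val a ^ (q ^ i - 1)" if "a \<in> monics d" for a
        using monics_nonzero[OF that] q_gt_1 by (simp add: power_diff)
      then have "poly P (\<theta> ^ (q ^ i)) = 0"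
        using sum_q_powers_monics[OF \<open>i < d\<close>] by (simp add: poly_P subst_at_theta_power)
      moreover have "(\<Prod>j<d. \<theta> ^ (q ^ i) - \<theta> ^ (q ^ j)) = 0"
        using \<open>i < d\<close> by (intro prod_zero) auto
      ultimately show "poly R (\<theta> ^ (q ^ i)) = 0"
        by (simp add: poly_R)
    qed
    moreover have "inj_on (\<lambda>i. \<theta> ^ (q ^ i)) {..<d}"
      using q_gt_1 by (auto simp: inj_on_def inj_theta_power)
    ultimately have "d \<le> card {x. poly R x = 0}"
      using poly_roots_finite[OF \<open>R \<noteq> 0\<close>] by (metis card_image card_lessThan card_mono)
    then show False
      using card_poly_roots_bound[OF \<open>R \<noteq> 0\<close>] \<open>degree R < d\<close> by simp
  qed
  then show ?thesis
    using poly_R[of t] by (simp add: poly_P w_def)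
qed

text \<open>
  Carlitz's evaluation.  The sums in the previous lemma, taken over all degrees up to \<open>d\<close>, add
  up to a trivial zero at \<open>t = \<theta>\<^bsup>q^d\<^esup>\<close>.  These equations determine the sums recursively, and
  the telescoping identity shows that \<open>1/\<ell>\<^sub>d\<close> solves them.
\<close>

lemma sum_inverse_monics: "(\<Sum>a\<in>monics d. 1 / val a) = 1 / ell \<iota> d"
proof (induction d rule: less_induct)
  case (less d)
  show ?case
  proof (cases "d = 0")
    case True
    then show ?thesis
      by (simp add: monics_0)
  next
    case False
    define w where "w e = (\<Sum>a\<in>monics e. 1 / val a)" for e
    define B where "B e = (\<Prod>i<e. \<theta> ^ (q ^ d) - \<theta> ^ (q ^ i))" for e
    have "(\<Sum>a\<in>monics e. val a ^ (q ^ d - 1)) = w e * B e" for e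
    proof -
      have "val a ^ (q ^ d - 1) = subst_at \<iota> a (\<theta> ^ (q ^ d)) / val a" if "a \<in> monics e" for a
        using monics_nonzero[OF that] q_gt_1 by (simp add: power_diff subst_at_theta_power)
      then show ?thesis
        using twisted_sum_factorization[where t = "\<theta> ^ (q ^ d)" and d = e]
        by (simp add: w_def B_def)
    qed
    moreover have "(\<Sum>e<Suc d. \<Sum>a\<in>monics e. val a ^ (q ^ d - 1)) = 0"
    proof -
      have "1 < q ^ d"
        using False q_gt_1 by (intro one_less_power) auto
      moreover have "(q - 1) dvd (q ^ d - 1)"
        by (rule q_minus_1_dvd)
      ultimately show ?thesis
        using sum_powers_monics_upto[of "q ^ d - 1" "Suc d"] sum_q_powers_low[of d "Suc d"] by simp
    qed
    ultimately have 1: "(\<Sum>e\<le>d. w e * B e) = 0"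
      by (simp add: lessThan_Suc_atMost)
    have 2: "(\<Sum>e\<le>d. B e / ell \<iota> e) = 0"
    proof -
      obtain n where "d = Suc n"
        using False not0_implies_Suc by blast
      then show ?thesis
        using sum_newton_basis[where n = d and t = "\<theta> ^ (q ^ d)"] by (simp add: B_def)
    qed
    have "{..d} = insert d {..<d}"
      by auto
    then have "w d * B d = B d / ell \<iota> d"
      using 1 2 less.IH by (simp add: w_def add_eq_0_iff2 flip: divide_inverse)
    moreover have "B d \<noteq> 0"
      using q_gt_1 by (auto simp: B_def inj_theta_power)
    ultimately show ?thesis
      by (simp add: w_def field_simps)
  qed
qed


section \<open>Linear combinations over the rational functions\<close>

abbreviation K :: "'c set" where "K \<equiv> base_K \<iota>"

lemma K_eq: "K = {val a / val b | a b. b \<noteq> 0}"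
  by (simp add: base_K_def val_def)

lemma val_in_K: "val a \<in> K"
  unfolding K_eq by (intro CollectI exI[of _ a] exI[of _ 1]) simp

lemma K_add: "x \<in> K \<Longrightarrow> y \<in> K \<Longrightarrow> x + y \<in> K"
proof -
  assume "x \<in> K" "y \<in> K"
  then obtain a b c d where *: "x = val a / val b" "y = val c / val d" "b \<noteq> 0" "d \<noteq> 0"
    by (auto simp: K_eq)
  have "x + y = val (a * d + c * b) / val (b * d)" "b * d \<noteq> 0"
    using *(3,4) unfolding *(1,2) by (simp_all add: val_add val_mult add_frac_eq)
  then show ?thesis
    unfolding K_eq by blast
qed

lemma K_mult: "x \<in> K \<Longrightarrow> y \<in> K \<Longrightarrow> x * y \<in> K"
proof -
  assume "x \<in> K" "y \<in> K"
  then obtain a b c d where *: "x = val a / val b" "y = val c / val d" "b \<noteq> 0" "d \<noteq> 0"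
    by (auto simp: K_eq)
  then have "x * y = val (a * c) / val (b * d)" "b * d \<noteq> 0"
    by (simp_all add: val_mult)
  then show ?thesis
    unfolding K_eq by blast
qed

lemma K_divide: "x \<in> K \<Longrightarrow> y \<in> K \<Longrightarrow> x / y \<in> K"
proof (cases "y = 0")
  case True
  then show ?thesis
    using val_in_K[of 0] by simp
next
  case False
  assume "x \<in> K" "y \<in> K"
  then obtain a b c d where *: "x = val a / val b" "y = val c / val d" "b \<noteq> 0" "d \<noteq> 0"
    by (auto simp: K_eq)
  with False have "x / y = val (a * d) / val (b * c)" "b * c \<noteq> 0"
    by (auto simp: val_mult)
  then show ?thesis
    unfolding K_eq by blast
qed

lemma K_0: "0 \<in> K" and K_1: "1 \<in> K"
  using val_in_K[of 0] val_in_K[of 1] by simp_all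

lemma const_in_K: "const c \<in> K"
  using val_in_K[of "[:c:]"] by (simp add: val_def subst_at_pCons)

lemma theta_in_K: "\<theta> \<in> K"
  using val_in_K[of "[:0, 1:]"] by (simp add: val_def subst_at_pCons)

lemma K_uminus: "x \<in> K \<Longrightarrow> - x \<in> K"
  using K_mult[of "const (- 1)" x] const_in_K[of "- 1"] const_add[of "- 1" 1]
  by (simp add: add_eq_0_iff2)

lemma K_sum: "(\<And>a. a \<in> A \<Longrightarrow> f a \<in> K) \<Longrightarrow> sum f A \<in> K"
  by (induction A rule: infinite_finite_induct) (auto intro: K_0 K_add)

lemma K_power: "x \<in> K \<Longrightarrow> x ^ n \<in> K"
  by (induction n) (auto intro: K_1 K_mult)

lemma K_of_nat: "of_nat n \<in> K"
  by (induction n) (auto intro: K_0 K_1 K_add)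

text \<open>
  Linear combinations over \<open>K\<close> of functions on an arbitrary set, generated one term at a time so
  that statements about them are proved by induction on the terms.
\<close>

inductive_set lin_span :: "('x \<Rightarrow> 'c) set \<Rightarrow> ('x \<Rightarrow> 'c) set" for B :: "('x \<Rightarrow> 'c) set" where
  zero: "(\<lambda>_. 0) \<in> lin_span B"
| step: "f \<in> lin_span B \<Longrightarrow> c \<in> K \<Longrightarrow> b \<in> B \<Longrightarrow> (\<lambda>x. f x + c * b x) \<in> lin_span B"

lemma lin_span_base: "b \<in> B \<Longrightarrow> b \<in> lin_span B"
  using lin_span.step[OF lin_span.zero K_1, of b B] by simp

lemma lin_span_add:
  assumes "f \<in> lin_span B" "g \<in> lin_span B"
  shows "(\<lambda>x. f x + g x) \<in> lin_span B"
  using assms(2)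
proof induction
  case (step g c b)
  then show ?case
    using lin_span.step[of "\<lambda>x. f x + g x" B c b] by (simp add: add.assoc)
qed (simp add: assms(1))

lemma lin_span_cmult:
  assumes "f \<in> lin_span B" "c \<in> K"
  shows "(\<lambda>x. c * f x) \<in> lin_span B"
  using assms(1)
proof induction
  case (step f d b)
  then show ?case
    using lin_span.step[of "\<lambda>x. c * f x" B "c * d" b] assms(2)
    by (simp add: K_mult distrib_left mult.assoc)
qed (simp add: lin_span.zero)

lemma lin_span_diff:
  assumes "f \<in> lin_span B" "g \<in> lin_span B"
  shows "(\<lambda>x. f x - g x) \<in> lin_span B"
  using lin_span_add[OF assms(1) lin_span_cmult[OF assms(2) K_uminus[OF K_1]]] by simp

lemma lin_span_sum:
  assumes "\<And>i. i \<in> I \<Longrightarrow> f i \<in> lin_span B"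
  shows "(\<lambda>x. \<Sum>i\<in>I. f i x) \<in> lin_span B"
  using assms
  by (induction I rule: infinite_finite_induct) (auto intro: lin_span.zero lin_span_add)

text \<open>
  A linear operator, applied to a linear combination, is controlled by its effect on the
  generators.
\<close>

lemma lin_span_map:
  assumes "f \<in> lin_span B"
    and "\<And>b. b \<in> B \<Longrightarrow> \<phi> b \<in> lin_span B'"
    and "\<phi> (\<lambda>_. 0) = (\<lambda>_. 0)"
    and "\<And>f c b. \<phi> (\<lambda>x. f x + c * b x) = (\<lambda>x. \<phi> f x + c * \<phi> b x)"
  shows "\<phi> f \<in> lin_span B'"
  using assms(1)
proof induction
  case zero
  then show ?case
    by (simp add: assms(3) lin_span.zero)
next
  case (step f c b)
  then show ?case
    by (simp add: assms(4) lin_span_add lin_span_cmult assms(2))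
qed


section \<open>Truncated multiple sums and their products\<close>

definition psum :: "nat set \<Rightarrow> nat \<Rightarrow> nat \<Rightarrow> (nat \<Rightarrow> 'c) \<Rightarrow> 'c" where
  "psum U s d t = (\<Sum>a\<in>monics d. chi \<iota> U a t / val a ^ s)"

text \<open>
  The multiple sum over tuples whose largest degree is below \<open>d\<close>.
\<close>

primrec trunc :: "array \<Rightarrow> nat \<Rightarrow> (nat \<Rightarrow> 'c) \<Rightarrow> 'c" where
  "trunc [] d t = 1"
| "trunc (y # A) d t = (\<Sum>e<d. psum (fst y) (snd y) e t * trunc A e t)"

text \<open>
  The arguments are pairs \<open>(d, t)\<close>, so that the coefficients of a linear combination depend
  neither on the truncation degree nor on the variables.  Identities in this space therefore
  survive the limit \<open>d \<rightarrow> \<infinity>\<close>.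
\<close>

definition trunc_span :: "nat set \<Rightarrow> nat \<Rightarrow> (nat \<times> (nat \<Rightarrow> 'c) \<Rightarrow> 'c) set" where
  "trunc_span \<Sigma> n = lin_span {\<lambda>x. trunc A (fst x) (snd x) | A. admissible \<Sigma> A \<and> weight A = n}"

text \<open>
  The sums over tuples whose first entry has degree exactly \<open>d\<close>, instead of below \<open>d\<close>.
\<close>

definition layer_span :: "nat set \<Rightarrow> nat \<Rightarrow> (nat \<times> (nat \<Rightarrow> 'c) \<Rightarrow> 'c) set" where
  "layer_span \<Sigma> n = lin_span {\<lambda>x. psum U s (fst x) (snd x) * trunc A (fst x) (snd x) | U s A.
     admissible \<Sigma> ((U, s) # A) \<and> s + weight A = n}"

text \<open>
  What a product of two power sums of the same degree \<open>d\<close> produces in addition to a single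
  power sum of degree \<open>d\<close>.
\<close>

definition pair_span :: "nat set \<Rightarrow> nat \<Rightarrow> (nat \<times> (nat \<Rightarrow> 'c) \<Rightarrow> 'c) set" where
  "pair_span \<Sigma> n = lin_span {\<lambda>x. psum U j (fst x) (snd x) * trunc [(V, i)] (fst x) (snd x) | U V i j.
     U \<inter> V = {} \<and> U \<union> V = \<Sigma> \<and> 0 < i \<and> 0 < j \<and> i + j = n}"

lemma trunc_in_span:
  "admissible \<Sigma> A \<Longrightarrow> weight A = n \<Longrightarrow> (\<lambda>x. trunc A (fst x) (snd x)) \<in> trunc_span \<Sigma> n"
  unfolding trunc_span_def by (rule lin_span_base) blast

lemma sum_layers_in_span:
  assumes "h \<in> layer_span \<Sigma> n"
  shows "(\<lambda>x. \<Sum>e<fst x. h (e, snd x)) \<in> trunc_span \<Sigma> n"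
  using assms unfolding layer_span_def trunc_span_def
proof (rule lin_span_map)
  fix b :: "nat \<times> (nat \<Rightarrow> 'c) \<Rightarrow> 'c"
  assume "b \<in> {\<lambda>x. psum U s (fst x) (snd x) * trunc A (fst x) (snd x) | U s A.
     admissible \<Sigma> ((U, s) # A) \<and> s + weight A = n}"
  then obtain U s A where b: "b = (\<lambda>x. psum U s (fst x) (snd x) * trunc A (fst x) (snd x))"
    and A: "admissible \<Sigma> ((U, s) # A)" "s + weight A = n"
    by blast
  have "(\<lambda>x. \<Sum>e<fst x. b (e, snd x)) = (\<lambda>x. trunc ((U, s) # A) (fst x) (snd x))"
    by (simp add: b)
  then show "(\<lambda>x. \<Sum>e<fst x. b (e, snd x))
      \<in> lin_span {\<lambda>x. trunc A (fst x) (snd x) | A. admissible \<Sigma> A \<and> weight A = n}"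
    using A by (intro lin_span_base) (auto intro!: exI[of _ "(U, s) # A"])
qed (simp_all add: sum.distrib sum_distrib_left)

lemma psum_mult_in_layer_span:
  assumes "g \<in> trunc_span \<Sigma> n" "U \<inter> \<Sigma> = {}" "0 < s"
  shows "(\<lambda>x. psum U s (fst x) (snd x) * g x) \<in> layer_span (U \<union> \<Sigma>) (s + n)"
  using assms(1) unfolding layer_span_def trunc_span_def
proof (rule lin_span_map)
  fix b :: "nat \<times> (nat \<Rightarrow> 'c) \<Rightarrow> 'c"
  assume "b \<in> {\<lambda>x. trunc A (fst x) (snd x) | A. admissible \<Sigma> A \<and> weight A = n}"
  then obtain A where b: "b = (\<lambda>x. trunc A (fst x) (snd x))" and A: "admissible \<Sigma> A" "weight A = n"
    by blast
  have "U \<union> \<Sigma> - U = \<Sigma>"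
    using assms(2) by blast
  with A assms(3) have "admissible (U \<union> \<Sigma>) ((U, s) # A)"
    by (simp add: admissible_Cons)
  with A show "(\<lambda>x. psum U s (fst x) (snd x) * b x)
      \<in> lin_span {\<lambda>x. psum U' s' (fst x) (snd x) * trunc A (fst x) (snd x) | U' s' A.
          admissible (U \<union> \<Sigma>) ((U', s') # A) \<and> s' + weight A = s + n}"
    unfolding b by (intro lin_span_base) blast
qed (simp_all add: algebra_simps)

text \<open>
  The terms with \<open>a \<noteq> b\<close> of a product of two power sums of the same degree, with an additional
  denominator \<open>(a - b)\<^sup>i\<close> in which partial fractions accumulate.
\<close>

definition off_diagonal_sum ::
  "nat set \<Rightarrow> nat set \<Rightarrow> nat \<Rightarrow> nat \<Rightarrow> nat \<Rightarrow> nat \<times> (nat \<Rightarrow> 'c) \<Rightarrow> 'c" where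
  "off_diagonal_sum U V i s r x = (\<Sum>b\<in>monics (fst x). \<Sum>a\<in>{a \<in> monics (fst x). a \<noteq> b}.
     chi \<iota> U a (snd x) * chi \<iota> V b (snd x) / (val (a - b) ^ i * val a ^ s * val b ^ r))"

lemma chi_shift:
  assumes "finite U"
  shows "chi \<iota> U (b + smult c n) t =
    (\<Sum>W\<in>Pow U. const c ^ card (U - W) * chi \<iota> W b t * chi \<iota> (U - W) n t)"
proof -
  have "chi \<iota> U (b + smult c n) t = (\<Prod>k\<in>U. subst_at \<iota> b (t k) + const c * subst_at \<iota> n (t k))"
    by (simp add: chi_def subst_at_add subst_at_smult)
  also have "\<dots> = (\<Sum>W\<in>Pow U. const c ^ card (U - W) * chi \<iota> W b t * chi \<iota> (U - W) n t)"
    using assms by (subst prod_add) (auto simp: chi_def prod.distrib mult_ac intro!: sum.cong)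
  finally show ?thesis .
qed

lemma chi_Un: "finite U \<Longrightarrow> finite V \<Longrightarrow> U \<inter> V = {} \<Longrightarrow> chi \<iota> (U \<union> V) a t = chi \<iota> U a t * chi \<iota> V a t"
  by (simp add: chi_def prod.union_disjoint)

text \<open>
  Once only powers of \<open>a - b\<close> and \<open>b\<close> are left in the denominator, write \<open>a = b + c n\<close> with a
  nonzero constant \<open>c\<close> and \<open>n\<close> monic of smaller degree.  Expanding \<open>\<chi>\<^sub>U(b + c n)\<close> distributes \<open>U\<close>
  over \<open>b\<close> and \<open>n\<close>, and the sum over \<open>c\<close> is a constant in \<open>F\<^sub>q\<close>.
\<close>

lemma off_diagonal_sum_expand:
  assumes "finite U" "finite V" "U \<inter> V = {}"
  shows "off_diagonal_sum U V i 0 r x = (\<Sum>W\<in>Pow U. (\<Sum>c\<in>UNIV - {0}. const c ^ card (U - W) / const c ^ i)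
     * (psum (W \<union> V) r (fst x) (snd x) * trunc [(U - W, i)] (fst x) (snd x)))"
proof -
  obtain d t where x: "x = (d, t)"
    by (cases x)
  define \<alpha> where "\<alpha> W c = const c ^ card (U - W) / const c ^ i" for W c
  define \<beta> where "\<beta> W b = chi \<iota> W b t * chi \<iota> V b t / val b ^ r" for W b
  define \<gamma> where "\<gamma> W n = chi \<iota> (U - W) n t / val n ^ i" for W n
  define F where "F W c b n = \<alpha> W c * (\<beta> W b * \<gamma> W n)" for W c b n
  have shift: "(\<Sum>a\<in>{a \<in> monics d. a \<noteq> b}. g a) = (\<Sum>u\<in>low d - {0}. g (b + u))"
    if b: "b \<in> monics d" for b and g :: "'q poly \<Rightarrow> 'c"
  proof (rule sum.reindex_bij_witness[of _ "\<lambda>u. b + u" "\<lambda>a. a - b"])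
    fix u
    assume u: "u \<in> low d - {0}"
    obtain b' where "b' \<in> low d" "b = monom 1 d + b'"
      using b bij_betw_imp_surj_on[OF bij_betw_monics[of d]] by blast
    then have "b' + u \<in> low d" "b + u = monom 1 d + (b' + u)"
      using u by (simp_all add: low_def)
    then have "b + u \<in> monics d"
      using bij_betw_imp_surj_on[OF bij_betw_monics[of d]] by blast
    then show "b + u \<in> {a \<in> monics d. a \<noteq> b}"
      using u by simp
  qed (use b in \<open>auto simp: low_def monics_def le_less coeff_eq_0\<close>)
  have summand: "chi \<iota> U (b + smult c n) t * chi \<iota> V b t / (val (b + smult c n - b) ^ i * val b ^ r)
      = (\<Sum>W\<in>Pow U. F W c b n)" for c b n
    unfolding chi_shift[OF assms(1)] sum_distrib_right sum_divide_distrib F_def \<alpha>_def \<beta>_def \<gamma>_def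
    by (intro sum.cong) (simp_all add: val_smult power_mult_distrib mult_ac)
  have "off_diagonal_sum U V i 0 r x
      = (\<Sum>b\<in>monics d. \<Sum>c\<in>UNIV - {0}. \<Sum>e<d. \<Sum>n\<in>monics e. \<Sum>W\<in>Pow U. F W c b n)"
    unfolding off_diagonal_sum_def x by (simp add: shift sum_low_by_monics flip: summand)
  also have "\<dots> = (\<Sum>b\<in>monics d. \<Sum>c\<in>UNIV - {0}. \<Sum>W\<in>Pow U. \<Sum>e<d. \<Sum>n\<in>monics e. F W c b n)"
  proof -
    have "(\<Sum>e<d. \<Sum>n\<in>monics e. \<Sum>W\<in>Pow U. F W c b n)
        = (\<Sum>W\<in>Pow U. \<Sum>e<d. \<Sum>n\<in>monics e. F W c b n)" for b c
    proof -
      have "(\<Sum>e<d. \<Sum>n\<in>monics e. \<Sum>W\<in>Pow U. F W c b n)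
          = (\<Sum>e<d. \<Sum>W\<in>Pow U. \<Sum>n\<in>monics e. F W c b n)"
        by (intro sum.cong[OF refl] sum.swap)
      also have "\<dots> = (\<Sum>W\<in>Pow U. \<Sum>e<d. \<Sum>n\<in>monics e. F W c b n)"
        by (rule sum.swap)
      finally show ?thesis .
    qed
    then show ?thesis
      by simp
  qed
  also have "\<dots> = (\<Sum>W\<in>Pow U. \<Sum>b\<in>monics d. \<Sum>c\<in>UNIV - {0}. \<Sum>e<d. \<Sum>n\<in>monics e. F W c b n)"
  proof -
    have "(\<Sum>c\<in>UNIV - {0}. \<Sum>W\<in>Pow U. \<Sum>e<d. \<Sum>n\<in>monics e. F W c b n)
        = (\<Sum>W\<in>Pow U. \<Sum>c\<in>UNIV - {0}. \<Sum>e<d. \<Sum>n\<in>monics e. F W c b n)" for b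
      by (rule sum.swap)
    then show ?thesis
      by (simp add: sum.swap[of _ "Pow U" "monics d"])
  qed
  also have "\<dots> = (\<Sum>W\<in>Pow U. (\<Sum>c\<in>UNIV - {0}. const c ^ card (U - W) / const c ^ i)
     * (psum (W \<union> V) r d t * trunc [(U - W, i)] d t))"
  proof (rule sum.cong[OF refl])
    fix W
    assume "W \<in> Pow U"
    then have W: "finite W" "W \<inter> V = {}"
      using assms finite_subset by auto
    have "psum (W \<union> V) r d t = (\<Sum>b\<in>monics d. \<beta> W b)"
      using W assms(2) by (simp add: psum_def chi_Un \<beta>_def)
    moreover have "trunc [(U - W, i)] d t = (\<Sum>e<d. \<Sum>n\<in>monics e. \<gamma> W n)"
      by (simp add: psum_def \<gamma>_def)
    moreover have "(\<Sum>b\<in>monics d. \<Sum>c\<in>UNIV - {0}. \<Sum>e<d. \<Sum>n\<in>monics e. F W c b n)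
      = (\<Sum>c\<in>UNIV - {0}. \<alpha> W c) * ((\<Sum>b\<in>monics d. \<beta> W b) * (\<Sum>e<d. \<Sum>n\<in>monics e. \<gamma> W n))"
      unfolding F_def by (simp flip: sum_distrib_left sum_distrib_right)
    ultimately show "(\<Sum>b\<in>monics d. \<Sum>c\<in>UNIV - {0}. \<Sum>e<d. \<Sum>n\<in>monics e. F W c b n)
      = (\<Sum>c\<in>UNIV - {0}. const c ^ card (U - W) / const c ^ i)
        * (psum (W \<union> V) r d t * trunc [(U - W, i)] d t)"
      by (simp add: \<alpha>_def)
  qed
  finally show ?thesis
    by (simp add: x)
qed

lemma off_diagonal_sum_base:
  assumes "finite U" "finite V" "U \<inter> V = {}" "0 < i" "0 < r"
  shows "off_diagonal_sum U V i 0 r \<in> pair_span (U \<union> V) (i + r)"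
proof -
  have "(\<lambda>x. psum (W \<union> V) r (fst x) (snd x) * trunc [(U - W, i)] (fst x) (snd x))
      \<in> pair_span (U \<union> V) (i + r)" if "W \<in> Pow U" for W
  proof -
    have "(W \<union> V) \<inter> (U - W) = {}" "(W \<union> V) \<union> (U - W) = U \<union> V"
      using that assms(3) by auto
    then show ?thesis
      unfolding pair_span_def using assms(4,5) by (intro lin_span_base) blast
  qed
  then have "(\<lambda>x. \<Sum>W\<in>Pow U. (\<Sum>c\<in>UNIV - {0}. const c ^ card (U - W) / const c ^ i)
     * (psum (W \<union> V) r (fst x) (snd x) * trunc [(U - W, i)] (fst x) (snd x)))
    \<in> pair_span (U \<union> V) (i + r)"
    unfolding pair_span_def
    by (intro lin_span_sum lin_span_cmult K_sum K_divide K_power const_in_K)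
  then show ?thesis
    using off_diagonal_sum_expand[OF assms(1-3)] by presburger
qed

lemma off_diagonal_sum_swap:
  "off_diagonal_sum U V i s r x = (- 1) ^ i * off_diagonal_sum V U i r s x"
proof -
  have "off_diagonal_sum U V i s r x
    = (\<Sum>a\<in>monics (fst x). \<Sum>b\<in>{b \<in> monics (fst x). a \<noteq> b}.
     chi \<iota> U a (snd x) * chi \<iota> V b (snd x) / (val (a - b) ^ i * val a ^ s * val b ^ r))"
    unfolding off_diagonal_sum_def by (rule sum.swap_restrict) simp_all
  also have "\<dots> = (- 1) ^ i * off_diagonal_sum V U i r s x"
    unfolding off_diagonal_sum_def sum_distrib_left
  proof (intro sum.cong)
    fix a b
    have "val (a - b) ^ i = (- 1) ^ i * val (b - a) ^ i"
      by (simp add: val_diff flip: power_mult_distrib)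
    moreover have "(- 1 :: 'c) ^ i * (- 1) ^ i = 1"
      by (simp flip: power_mult_distrib)
    ultimately show "chi \<iota> U a (snd x) * chi \<iota> V b (snd x) / (val (a - b) ^ i * val a ^ s * val b ^ r)
      = (- 1) ^ i * (chi \<iota> V b (snd x) * chi \<iota> U a (snd x) / (val (b - a) ^ i * val b ^ r * val a ^ s))"
      by (cases "even i") (simp_all add: mult_ac)
  qed auto
  finally show ?thesis .
qed

text \<open>
  Induction along the partial fraction step
  \<open>(a - b) / (a\<^sup>s b\<^sup>r) = 1 / (a\<^bsup>s-1\<^esup> b\<^sup>r) - 1 / (a\<^sup>s b\<^bsup>r-1\<^esup>)\<close>, until one of the two exponents is 0.
\<close>

lemma off_diagonal_sum_in_pair_span:
  assumes "finite U" "finite V" "U \<inter> V = {}" "0 < s + r" "0 < i \<or> 0 < s \<and> 0 < r"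
  shows "off_diagonal_sum U V i s r \<in> pair_span (U \<union> V) (i + s + r)"
  using assms(4,5)
proof (induction "s + r" arbitrary: i s r rule: less_induct)
  case less
  consider "s = 0" | "r = 0" | s' r' where "s = Suc s'" "r = Suc r'"
    by (meson not0_implies_Suc)
  then show ?case
  proof cases
    case 1
    then show ?thesis
      using less.prems off_diagonal_sum_base[OF assms(1-3)] by simp
  next
    case 2
    have "off_diagonal_sum V U i 0 s \<in> pair_span (U \<union> V) (i + s)"
      using off_diagonal_sum_base[of V U i s] assms(1-3) less.prems 2 by (simp add: Int_commute Un_commute)
    then have "(\<lambda>x. (- 1) ^ i * off_diagonal_sum V U i 0 s x) \<in> pair_span (U \<union> V) (i + s)"
      unfolding pair_span_def by (intro lin_span_cmult K_power K_uminus K_1)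
    moreover have "off_diagonal_sum U V i s 0 = (\<lambda>x. (- 1) ^ i * off_diagonal_sum V U i 0 s x)"
      by (rule ext) (rule off_diagonal_sum_swap)
    ultimately show ?thesis
      using 2 by simp
  next
    case 3
    have "off_diagonal_sum U V (Suc i) s' r \<in> pair_span (U \<union> V) (Suc i + s' + r)"
      "off_diagonal_sum U V (Suc i) s r' \<in> pair_span (U \<union> V) (Suc i + s + r')"
      using 3 by (intro less.hyps; simp)+
    then have "(\<lambda>x. off_diagonal_sum U V (Suc i) s' r x - off_diagonal_sum U V (Suc i) s r' x)
        \<in> pair_span (U \<union> V) (i + s + r)"
      unfolding pair_span_def using 3 by (intro lin_span_diff) simp_all
    moreover have "off_diagonal_sum U V i s r
        = (\<lambda>x. off_diagonal_sum U V (Suc i) s' r x - off_diagonal_sum U V (Suc i) s r' x)"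
    proof
      fix x
      have "C / (val (a - b) ^ i * val a ^ s * val b ^ r)
          = C / (val (a - b) ^ Suc i * val a ^ s' * val b ^ r)
            - C / (val (a - b) ^ Suc i * val a ^ s * val b ^ r')"
        if "a \<noteq> b" "a \<noteq> 0" "b \<noteq> 0" for a b C
      proof -
        have "val (a - b) \<noteq> 0" "val a \<noteq> 0" "val b \<noteq> 0"
          using that by simp_all
        then show ?thesis
          unfolding 3 by (simp add: divide_simps) (simp add: val_diff algebra_simps)
      qed
      then show "off_diagonal_sum U V i s r x
          = off_diagonal_sum U V (Suc i) s' r x - off_diagonal_sum U V (Suc i) s r' x"
        unfolding off_diagonal_sum_def sum_subtractf[symmetric]
        by (intro sum.cong refl) (auto dest!: monics_nonzero)
    qed
    ultimately show ?thesis
      by simp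
  qed
qed

lemma psum_mult_psum:
  assumes "finite U" "finite V" "U \<inter> V = {}"
  shows "psum U s (fst x) (snd x) * psum V r (fst x) (snd x)
    = psum (U \<union> V) (s + r) (fst x) (snd x) + off_diagonal_sum U V 0 s r x"
proof -
  define g where "g a b = chi \<iota> U a (snd x) * chi \<iota> V b (snd x) / (val a ^ s * val b ^ r)" for a b
  have "psum U s (fst x) (snd x) * psum V r (fst x) (snd x)
      = (\<Sum>b\<in>monics (fst x). \<Sum>a\<in>monics (fst x). g a b)"
    unfolding psum_def sum_product g_def by (subst sum.swap) simp
  also have "\<dots> = (\<Sum>b\<in>monics (fst x). g b b + (\<Sum>a\<in>{a \<in> monics (fst x). a \<noteq> b}. g a b))"
  proof (rule sum.cong[OF refl])
    fix b
    assume b: "b \<in> monics (fst x)"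
    have "{a \<in> monics (fst x). a \<noteq> b} = monics (fst x) - {b}"
      by auto
    with b show "(\<Sum>a\<in>monics (fst x). g a b)
        = g b b + (\<Sum>a\<in>{a \<in> monics (fst x). a \<noteq> b}. g a b)"
      by (simp add: sum.remove)
  qed
  also have "\<dots> = psum (U \<union> V) (s + r) (fst x) (snd x) + off_diagonal_sum U V 0 s r x"
    using assms
    by (simp add: sum.distrib g_def psum_def off_diagonal_sum_def chi_Un power_add)
  finally show ?thesis .
qed

lemma sum_mult_sum_lessThan:
  fixes f g :: "nat \<Rightarrow> 'a::comm_ring"
  shows "(\<Sum>e<d. f e) * (\<Sum>e<d. g e)
    = (\<Sum>e<d. f e * (\<Sum>k<e. g k) + g e * (\<Sum>k<e. f k) + f e * g e)"
  by (induction d) (simp_all add: algebra_simps)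

text \<open>
  The extension from the generators to the whole span is stated with a hypothesis on fixed
  weights, because it is needed inside the induction on the weight.
\<close>

lemma trunc_span_mult_lift:
  assumes "\<And>A B. admissible \<Sigma> A \<Longrightarrow> weight A = n \<Longrightarrow> admissible \<Sigma>' B \<Longrightarrow> weight B = n' \<Longrightarrow>
      (\<lambda>x. trunc A (fst x) (snd x) * trunc B (fst x) (snd x)) \<in> trunc_span (\<Sigma> \<union> \<Sigma>') (n + n')"
    and f: "f \<in> trunc_span \<Sigma> n" and g: "g \<in> trunc_span \<Sigma>' n'"
  shows "(\<lambda>x. f x * g x) \<in> trunc_span (\<Sigma> \<union> \<Sigma>') (n + n')"
  using f unfolding trunc_span_def
proof (rule lin_span_map)
  fix b :: "nat \<times> (nat \<Rightarrow> 'c) \<Rightarrow> 'c"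
  assume "b \<in> {\<lambda>x. trunc A (fst x) (snd x) | A. admissible \<Sigma> A \<and> weight A = n}"
  then obtain A where A: "b = (\<lambda>x. trunc A (fst x) (snd x))" "admissible \<Sigma> A" "weight A = n"
    by blast
  show "(\<lambda>x. b x * g x) \<in> lin_span {\<lambda>x. trunc A (fst x) (snd x) | A.
      admissible (\<Sigma> \<union> \<Sigma>') A \<and> weight A = n + n'}"
    using g unfolding trunc_span_def
  proof (rule lin_span_map)
    fix b' :: "nat \<times> (nat \<Rightarrow> 'c) \<Rightarrow> 'c"
    assume "b' \<in> {\<lambda>x. trunc A (fst x) (snd x) | A. admissible \<Sigma>' A \<and> weight A = n'}"
    then obtain B where B: "b' = (\<lambda>x. trunc B (fst x) (snd x))" "admissible \<Sigma>' B" "weight B = n'"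
      by blast
    show "(\<lambda>x. b x * b' x) \<in> lin_span {\<lambda>x. trunc A (fst x) (snd x) | A.
        admissible (\<Sigma> \<union> \<Sigma>') A \<and> weight A = n + n'}"
      using assms(1)[OF A(2,3) B(2,3)] by (simp add: A(1) B(1) trunc_span_def)
  qed (simp_all add: algebra_simps)
qed (simp_all add: algebra_simps)

text \<open>
  Sort a pair of strictly decreasing tuples by comparing the leading degrees.  If they differ,
  the larger one splits off.  If they agree, the two leading power sums merge into
  a single one and combinations of \<open>psum U j * trunc [(V, i)]\<close> with \<open>j > 0\<close>, and the remaining product of
  truncated sums has smaller total weight.
\<close>

lemma trunc_mult_trunc:
  assumes "finite \<Sigma>" "finite \<Sigma>'" "\<Sigma> \<inter> \<Sigma>' = {}"
    and "admissible \<Sigma> A" "admissible \<Sigma>' B"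
  shows "(\<lambda>x. trunc A (fst x) (snd x) * trunc B (fst x) (snd x))
    \<in> trunc_span (\<Sigma> \<union> \<Sigma>') (weight A + weight B)"
  using assms
proof (induction "weight A + weight B" arbitrary: A B \<Sigma> \<Sigma>' rule: less_induct)
  case less
  have span_mult: "(\<lambda>x. f x * g x) \<in> trunc_span (S \<union> S') (n + n')"
    if "f \<in> trunc_span S n" "g \<in> trunc_span S' n'" "n + n' < weight A + weight B"
      "finite S" "finite S'" "S \<inter> S' = {}" for f g S S' n n'
  proof (rule trunc_span_mult_lift[OF _ that(1,2)])
    fix C D
    assume "admissible S C" "weight C = n" "admissible S' D" "weight D = n'"
    then show "(\<lambda>x. trunc C (fst x) (snd x) * trunc D (fst x) (snd x)) \<in> trunc_span (S \<union> S') (n + n')"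
      using less.hyps[of C D S S'] that(3-) by simp
  qed
  show ?case
  proof (cases A)
    case Nil
    then show ?thesis
      using less.prems trunc_in_span by simp
  next
    case (Cons y A')
    show ?thesis
    proof (cases B)
      case Nil
      then show ?thesis
        using less.prems trunc_in_span by simp
    next
      case B: (Cons z B')
      obtain U s V r where y: "y = (U, s)" and z: "z = (V, r)"
        by fastforce
      define S S' where "S = \<Sigma> - U" and "S' = \<Sigma>' - V"
      have adm: "U \<subseteq> \<Sigma>" "0 < s" "admissible S A'" "V \<subseteq> \<Sigma>'" "0 < r" "admissible S' B'"
        using less.prems(4,5) by (simp_all add: Cons B y z admissible_Cons S_def S'_def)
      have fin: "finite U" "finite V" "finite S" "finite S'"
        using adm less.prems(1,2) by (auto simp: S_def S'_def intro: finite_subset)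
      have disj: "U \<inter> V = {}" "S \<inter> \<Sigma>' = {}" "\<Sigma> \<inter> S' = {}" "S \<inter> S' = {}"
          "U \<inter> (S \<union> \<Sigma>') = {}" "V \<inter> (\<Sigma> \<union> S') = {}" "(U \<union> V) \<inter> (S \<union> S') = {}"
        using adm less.prems(3) by (auto simp: S_def S'_def)
      have un: "U \<union> (S \<union> \<Sigma>') = \<Sigma> \<union> \<Sigma>'" "V \<union> (\<Sigma> \<union> S') = \<Sigma> \<union> \<Sigma>'"
          "(U \<union> V) \<union> (S \<union> S') = \<Sigma> \<union> \<Sigma>'"
        using adm by (auto simp: S_def S'_def)
      define w where "w = weight A + weight B"
      have w: "w = s + (weight A' + weight B)" "w = r + (weight A + weight B')"
          "w = (s + r) + (weight A' + weight B')"
        by (simp_all add: w_def Cons B y z)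
      have A': "(\<lambda>x. trunc A' (fst x) (snd x)) \<in> trunc_span S (weight A')"
        and A: "(\<lambda>x. trunc A (fst x) (snd x)) \<in> trunc_span \<Sigma> (weight A)"
        and B': "(\<lambda>x. trunc B' (fst x) (snd x)) \<in> trunc_span S' (weight B')"
        and B: "(\<lambda>x. trunc B (fst x) (snd x)) \<in> trunc_span \<Sigma>' (weight B)"
        using adm less.prems by (auto intro: trunc_in_span)
      define rest where "rest x = trunc A' (fst x) (snd x) * trunc B' (fst x) (snd x)" for x
      have rest: "rest \<in> trunc_span (S \<union> S') (weight A' + weight B')"
        unfolding rest_def using adm fin disj w w_def by (intro span_mult A' B') auto
      \<comment> \<open>The leading degree of the first tuple is larger, smaller, or equal.\<close>
      define h1 where "h1 x = psum U s (fst x) (snd x)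
        * (trunc A' (fst x) (snd x) * trunc B (fst x) (snd x))" for x
      define h2 where "h2 x = psum V r (fst x) (snd x)
        * (trunc A (fst x) (snd x) * trunc B' (fst x) (snd x))" for x
      define h3 where "h3 x = (psum U s (fst x) (snd x) * psum V r (fst x) (snd x)) * rest x" for x
      have h1: "h1 \<in> layer_span (\<Sigma> \<union> \<Sigma>') w"
        unfolding h1_def w(1) un(1)[symmetric] using adm fin disj w w_def less.prems
        by (intro psum_mult_in_layer_span span_mult A' B) auto
      have h2: "h2 \<in> layer_span (\<Sigma> \<union> \<Sigma>') w"
        unfolding h2_def w(2) un(2)[symmetric] using adm fin disj w w_def less.prems
        by (intro psum_mult_in_layer_span span_mult A B') auto
      have h3: "h3 \<in> layer_span (\<Sigma> \<union> \<Sigma>') w"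
      proof -
        have od: "off_diagonal_sum U V 0 s r \<in> lin_span {\<lambda>x. psum W j (fst x) (snd x)
              * trunc [(W', i)] (fst x) (snd x) | W W' i j.
              W \<inter> W' = {} \<and> W \<union> W' = U \<union> V \<and> 0 < i \<and> 0 < j \<and> i + j = s + r}"
          using off_diagonal_sum_in_pair_span[OF fin(1,2) disj(1), of s r 0] adm
          by (simp add: pair_span_def)
        have "(\<lambda>x. off_diagonal_sum U V 0 s r x * rest x) \<in> layer_span (\<Sigma> \<union> \<Sigma>') w"
          using od unfolding layer_span_def
        proof (rule lin_span_map)
          fix b :: "nat \<times> (nat \<Rightarrow> 'c) \<Rightarrow> 'c"
          assume "b \<in> {\<lambda>x. psum W j (fst x) (snd x) * trunc [(W', i)] (fst x) (snd x) | W W' i j.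
            W \<inter> W' = {} \<and> W \<union> W' = U \<union> V \<and> 0 < i \<and> 0 < j \<and> i + j = s + r}"
          then obtain W W' i j where
            b: "b = (\<lambda>x. psum W j (fst x) (snd x) * trunc [(W', i)] (fst x) (snd x))"
            and W: "W \<inter> W' = {}" "W \<union> W' = U \<union> V" "0 < i" "0 < j" "i + j = s + r"
            by auto
          have "(\<lambda>x. trunc [(W', i)] (fst x) (snd x)) \<in> trunc_span W' i"
            using W by (intro trunc_in_span) (simp_all add: admissible_Cons)
          moreover have "W' \<inter> (S \<union> S') = {}" "W \<inter> (W' \<union> (S \<union> S')) = {}"
              "W \<union> (W' \<union> (S \<union> S')) = \<Sigma> \<union> \<Sigma>'" "finite W'"
            using W un(3) disj(7) fin finite_subset[of W' "U \<union> V"] by auto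
          ultimately have "(\<lambda>x. psum W j (fst x) (snd x) * (trunc [(W', i)] (fst x) (snd x) * rest x))
              \<in> layer_span (W \<union> (W' \<union> (S \<union> S'))) (j + (i + (weight A' + weight B')))"
            using W fin w w_def by (intro psum_mult_in_layer_span span_mult rest) auto
          moreover have "j + (i + (weight A' + weight B')) = w"
            using W w by simp
          ultimately show "(\<lambda>x. b x * rest x) \<in> lin_span {\<lambda>x. psum U s (fst x) (snd x)
              * trunc A (fst x) (snd x) | U s A. admissible (\<Sigma> \<union> \<Sigma>') ((U, s) # A) \<and> s + weight A = w}"
            using \<open>W \<union> (W' \<union> (S \<union> S')) = \<Sigma> \<union> \<Sigma>'\<close>
            by (simp only: b mult.assoc layer_span_def)
        qed (simp_all add: algebra_simps)
        moreover have "(\<lambda>x. psum (U \<union> V) (s + r) (fst x) (snd x) * rest x)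
            \<in> layer_span (\<Sigma> \<union> \<Sigma>') w"
          unfolding w(3) un(3)[symmetric] using adm disj
          by (intro psum_mult_in_layer_span rest) auto
        moreover have "h3 = (\<lambda>x. psum (U \<union> V) (s + r) (fst x) (snd x) * rest x
            + off_diagonal_sum U V 0 s r x * rest x)"
          using fin disj by (simp add: h3_def fun_eq_iff psum_mult_psum distrib_right)
        ultimately show ?thesis
          unfolding layer_span_def by (simp add: lin_span_add)
      qed
      have "(\<lambda>x. h1 x + h2 x + h3 x) \<in> layer_span (\<Sigma> \<union> \<Sigma>') w"
        using h1 h2 h3 unfolding layer_span_def by (intro lin_span_add)
      then have "(\<lambda>x. \<Sum>e<fst x. h1 (e, snd x) + h2 (e, snd x) + h3 (e, snd x))
          \<in> trunc_span (\<Sigma> \<union> \<Sigma>') w"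
        by (rule sum_layers_in_span)
      moreover have "trunc A (fst x) (snd x) * trunc B (fst x) (snd x)
          = (\<Sum>e<fst x. h1 (e, snd x) + h2 (e, snd x) + h3 (e, snd x))" for x
        unfolding Cons \<open>B = z # B'\<close> y z trunc.simps fst_conv snd_conv sum_mult_sum_lessThan
        by (simp add: h1_def h2_def h3_def rest_def Cons \<open>B = z # B'\<close> y z mult_ac)
      ultimately show ?thesis
        by (simp add: w_def)
    qed
  qed
qed

lemma trunc_span_mult:
  assumes "f \<in> trunc_span \<Sigma> n" "g \<in> trunc_span \<Sigma>' n'"
    and "finite \<Sigma>" "finite \<Sigma>'" "\<Sigma> \<inter> \<Sigma>' = {}"
  shows "(\<lambda>x. f x * g x) \<in> trunc_span (\<Sigma> \<union> \<Sigma>') (n + n')"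
proof (rule trunc_span_mult_lift[OF _ assms(1,2)])
  fix A B
  assume "admissible \<Sigma> A" "weight A = n" "admissible \<Sigma>' B" "weight B = n'"
  then show "(\<lambda>x. trunc A (fst x) (snd x) * trunc B (fst x) (snd x)) \<in> trunc_span (\<Sigma> \<union> \<Sigma>') (n + n')"
    using trunc_mult_trunc[OF assms(3-5), of A B] by simp
qed


section \<open>Values at Frobenius twists of \<open>\<theta>\<close>\<close>

lemma bij_betw_monic_tuples: "bij_betw (\<lambda>(a, as). a # as)
    (SIGMA a:(\<Union>d<n. monics d). monic_tuples r (degree a)) (monic_tuples (Suc r) n)"
  unfolding bij_betw_def
proof
  show "inj_on (\<lambda>(a, as). a # as) (SIGMA a:(\<Union>d<n. monics d). monic_tuples r (degree a))"
    by (auto simp: inj_on_def)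
  show "(\<lambda>(a, as). a # as) ` (SIGMA a:(\<Union>d<n. monics d). monic_tuples r (degree a))
      = monic_tuples (Suc r) n"
  proof (intro equalityI subsetI)
    fix bs :: "'q poly list"
    assume "bs \<in> monic_tuples (Suc r) n"
    then show "bs \<in> (\<lambda>(a, as). a # as) ` (SIGMA a:(\<Union>d<n. monics d). monic_tuples r (degree a))"
      by (cases bs) (auto simp: monic_tuples_def monics_def)
  qed (auto simp: monic_tuples_def monics_def intro: less_trans)
qed

lemma finite_monic_tuples: "finite (monic_tuples r n :: 'q poly list set)"
proof (induction r arbitrary: n)
  case 0
  have "monic_tuples 0 n \<subseteq> {[] :: 'q poly list}"
    by (auto simp: monic_tuples_def)
  then show ?case
    by (rule finite_subset) simp
next
  case (Suc r)
  then show ?case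
    using bij_betw_finite[OF bij_betw_monic_tuples[where r = r and n = n]] by auto
qed

text \<open>
  Splitting off the first entry of a tuple gives the recursion of \<open>trunc\<close>.
\<close>

lemma sum_monic_tuples:
  "(\<Sum>as\<in>monic_tuples (length A) n. (\<Prod>i<length A. chi \<iota> (fst (A ! i)) (as ! i) t)
     / (\<Prod>i<length A. subst_at \<iota> (as ! i) \<theta> ^ snd (A ! i))) = trunc A n t"
proof (induction A arbitrary: n)
  case Nil
  have "monic_tuples 0 n = {[] :: 'q poly list}"
    by (auto simp: monic_tuples_def)
  then show ?case
    by simp
next
  case (Cons y A)
  define g where "g A as = (\<Prod>i<length A. chi \<iota> (fst (A ! i)) (as ! i) t)
     / (\<Prod>i<length A. subst_at \<iota> (as ! i) \<theta> ^ snd (A ! i))" for A as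
  have IH: "(\<Sum>as\<in>monic_tuples (length A) n. g A as) = trunc A n t" for n
    using Cons.IH by (simp add: g_def)
  have g_Cons: "g (y # A) (a # as) = chi \<iota> (fst y) a t / val a ^ snd y * g A as" for a as
    by (simp add: g_def val_def prod.lessThan_Suc_shift del: prod.lessThan_Suc)
  have "(\<Sum>as\<in>monic_tuples (length (y # A)) n. g (y # A) as)
      = (\<Sum>(a, as)\<in>(SIGMA a:(\<Union>d<n. monics d). monic_tuples (length A) (degree a)).
          g (y # A) (a # as))"
    using sum.reindex_bij_betw[OF bij_betw_monic_tuples[where n = n and r = "length A"], of "g (y # A)"]
    by (simp add: case_prod_unfold)
  also have "\<dots> = (\<Sum>a\<in>(\<Union>d<n. monics d). \<Sum>as\<in>monic_tuples (length A) (degree a). g (y # A) (a # as))"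
    by (subst sum.Sigma) (auto simp: finite_monic_tuples)
  also have "\<dots> = (\<Sum>a\<in>(\<Union>d<n. monics d). chi \<iota> (fst y) a t / val a ^ snd y * trunc A (degree a) t)"
    by (simp only: g_Cons IH flip: sum_distrib_left)
  also have "\<dots> = (\<Sum>d<n. \<Sum>a\<in>monics d. chi \<iota> (fst y) a t / val a ^ snd y * trunc A (degree a) t)"
    by (intro sum.UNION_disjoint) (auto simp: monics_disjoint)
  also have "\<dots> = (\<Sum>d<n. \<Sum>a\<in>monics d. chi \<iota> (fst y) a t / val a ^ snd y * trunc A d t)"
    by (intro sum.cong) (auto simp: monics_def)
  also have "\<dots> = trunc (y # A) n t"
    by (simp add: psum_def sum_distrib_right)
  finally show ?case
    by (simp add: g_def)
qed

text \<open>
  The twist \<open>\<chi>\<^sub>U(a)\<close> at \<open>\<theta>\<^bsup>q^k\<^esup>\<close> is \<open>a\<close> to this power.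
\<close>

definition twist_exp :: "nat set \<Rightarrow> (nat \<Rightarrow> nat) \<Rightarrow> nat" where
  "twist_exp U k = (\<Sum>r\<in>U. q ^ k r)"

lemma chi_theta_pow: "chi \<iota> U a (theta_pow \<iota> k) = val a ^ twist_exp U k"
  by (simp add: chi_def theta_pow_def subst_at_theta_power twist_exp_def power_sum flip: q_def)

lemma psum_theta_pow_ge:
  assumes "s \<le> twist_exp U k"
  shows "psum U s d (theta_pow \<iota> k) = (\<Sum>a\<in>monics d. val a ^ (twist_exp U k - s))"
  unfolding psum_def chi_theta_pow using assms
  by (intro sum.cong) (auto simp: power_diff dest: monics_nonzero)

lemma psum_theta_pow_le:
  assumes "twist_exp U k \<le> s"
  shows "psum U s d (theta_pow \<iota> k) = (\<Sum>a\<in>monics d. 1 / val a ^ (s - twist_exp U k))"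
  unfolding psum_def chi_theta_pow using assms
  by (intro sum.cong) (auto simp: power_diff dest: monics_nonzero)

text \<open>
  A power sum with a nonnegative exponent is 0 in large degrees; with a negative exponent its
  terms are small.
\<close>

lemma psum_theta_pow_tendsto_0: "(\<lambda>d. psum U s d (theta_pow \<iota> k)) \<longlonglongrightarrow> 0"
proof (cases "s \<le> twist_exp U k")
  case True
  have "psum U s d (theta_pow \<iota> k) = 0" if "twist_exp U k - s < d" for d
  proof -
    have "d \<le> d * (q - 1)"
      using mult_le_mono2[of 1 "q - 1" d] q_gt_1 by linarith
    with that have "twist_exp U k - s < d * (q - 1)"
      by (rule less_le_trans)
    then show ?thesis
      using True by (simp add: psum_theta_pow_ge sum_powers_monics)
  qed
  then have "\<forall>\<^sub>F d in sequentially. psum U s d (theta_pow \<iota> k) = 0"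
    using eventually_gt_at_top by (rule eventually_mono[rotated])
  then show ?thesis
    by (rule tendsto_eventually)
next
  case False
  have bound: "absv (psum U s d (theta_pow \<iota> k)) \<le> (1 / 2) ^ d" for d
  proof -
    have "absv (1 / val a ^ (s - twist_exp U k)) \<le> (1 / 2) ^ d" if "a \<in> monics d" for a
    proof -
      have "(2::real) ^ d \<le> (2 ^ d) ^ (s - twist_exp U k)"
        using False by (intro self_le_power) auto
      then show ?thesis
        using that monics_nonzero[OF that]
        by (simp add: absv_divide absv_power absv_val monics_def field_simps)
    qed
    then show ?thesis
      using False by (simp add: psum_theta_pow_le absv_sum_le)
  qed
  have "(\<lambda>d. absv (psum U s d (theta_pow \<iota> k))) \<longlonglongrightarrow> 0"
    by (rule tendsto_sandwich[OF _ _ tendsto_const LIMSEQ_realpow_zero[of "1 / 2"]])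
      (use bound in auto)
  then show ?thesis
    by (subst tendsto_dist_iff)
qed

lemma trunc_theta_pow_convergent: "convergent (\<lambda>n. trunc A n (theta_pow \<iota> k))"
proof (induction A)
  case (Cons y A)
  then obtain l where "(\<lambda>n. trunc A n (theta_pow \<iota> k)) \<longlonglongrightarrow> l"
    by (auto simp: convergent_def)
  from tendsto_mult[OF psum_theta_pow_tendsto_0 this]
  show ?case
    by (simp add: nonarch_convergent_sum)
qed (simp add: convergent_const)

lemma trunc_tendsto_zeta_A:
  "(\<lambda>n. trunc A n (theta_pow \<iota> k)) \<longlonglongrightarrow> zeta_A \<iota> A (theta_pow \<iota> k)"
  using trunc_theta_pow_convergent[of A k]
  by (simp add: zeta_A_def sum_monic_tuples convergent_LIMSEQ_iff)

lemma lin_span_subset_K_span: "f \<in> lin_span B \<Longrightarrow> f \<in> K_span \<iota> B"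
proof (induction rule: lin_span.induct)
  case zero
  show ?case
    unfolding K_span_def by (intro CollectI exI[of _ "{}"]) simp
next
  case (step f c0 b0)
  then obtain S c where f: "f = (\<lambda>t. \<Sum>b\<in>S. c b * b t)" "finite S" "S \<subseteq> B" "\<And>b. b \<in> S \<Longrightarrow> c b \<in> K"
    unfolding K_span_def by blast
  define c' where "c' b = (if b \<in> S then c b else 0) + (if b = b0 then c0 else 0)" for b
  have "(\<Sum>b\<in>insert b0 S. c' b * b t) = f t + c0 * b0 t" for t
  proof -
    have "(\<Sum>b\<in>insert b0 S. c' b * b t)
        = (\<Sum>b\<in>insert b0 S. (if b \<in> S then c b * b t else 0))
          + (\<Sum>b\<in>insert b0 S. (if b = b0 then c0 * b t else 0))"
      unfolding sum.distrib[symmetric] by (intro sum.cong) (auto simp: c'_def distrib_right)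
    also have "(\<Sum>b\<in>insert b0 S. (if b \<in> S then c b * b t else 0)) = f t"
      using f(2) unfolding f(1) by (intro sum.mono_neutral_cong_right) auto
    finally show ?thesis
      using f(2) by simp
  qed
  moreover have "c' b \<in> K" if "b \<in> insert b0 S" for b
    using f(4) step.hyps(2) by (auto simp: c'_def intro: K_0 K_add)
  ultimately show ?case
    unfolding K_span_def using f(2,3) step.hyps(3)
    by (intro CollectI exI[of _ "insert b0 S"] exI[of _ c']) auto
qed

text \<open>
  A linear combination of truncated sums converges at all Frobenius twists of \<open>\<theta>\<close> to the same
  linear combination of multiple zeta values.
\<close>

lemma trunc_span_limit:
  assumes "f \<in> trunc_span \<Sigma> n"
  obtains g where "g \<in> Z_space \<iota> \<Sigma> n"
    and "\<And>k. (\<lambda>N. f (N, theta_pow \<iota> k)) \<longlonglongrightarrow> g (theta_pow \<iota> k)"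
proof -
  let ?Z = "{zeta_A \<iota> A | A. admissible \<Sigma> A \<and> weight A = n}"
  have "\<exists>g\<in>lin_span ?Z. \<forall>k. (\<lambda>N. f (N, theta_pow \<iota> k)) \<longlonglongrightarrow> g (theta_pow \<iota> k)"
    using assms unfolding trunc_span_def
  proof induction
    case zero
    show ?case
      by (intro bexI[OF _ lin_span.zero]) simp
  next
    case (step f c b)
    then obtain g where g: "g \<in> lin_span ?Z"
      "\<And>k. (\<lambda>N. f (N, theta_pow \<iota> k)) \<longlonglongrightarrow> g (theta_pow \<iota> k)"
      by blast
    obtain A where A: "b = (\<lambda>x. trunc A (fst x) (snd x))" "admissible \<Sigma> A" "weight A = n"
      using step.hyps(3) by blast
    have "zeta_A \<iota> A \<in> ?Z"
      using A by blast
    with g(1) step.hyps(2) have "(\<lambda>t. g t + c * zeta_A \<iota> A t) \<in> lin_span ?Z"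
      by (rule lin_span.step)
    moreover have "(\<lambda>N. f (N, theta_pow \<iota> k) + c * b (N, theta_pow \<iota> k))
        \<longlonglongrightarrow> g (theta_pow \<iota> k) + c * zeta_A \<iota> A (theta_pow \<iota> k)" for k
      using g(2) trunc_tendsto_zeta_A by (simp add: A(1) tendsto_add tendsto_mult)
    ultimately show ?case
      by (intro bexI[where x = "\<lambda>t. g t + c * zeta_A \<iota> A t"]) auto
  qed
  then show ?thesis
    using that lin_span_subset_K_span unfolding Z_space_def by blast
qed



section \<open>A nonzero trivial multiple zeta value in the kernel\<close>

lemma power_sums_limit:
  assumes "(q - 1) dvd N"
  shows "(\<lambda>n. \<Sum>e<n. \<Sum>a\<in>monics e. val a ^ N) \<longlonglongrightarrow> (if N = 0 then 1 else 0)"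
proof -
  have "(\<Sum>e<n. \<Sum>a\<in>monics e. val a ^ N) = (if N = 0 then 1 else 0)" if "N < n" for n
  proof (cases "N = 0")
    case True
    have "(\<Sum>e<n. \<Sum>a\<in>monics e. val a ^ N) = (\<Sum>e\<in>{0}. \<Sum>a\<in>monics e. val a ^ N)"
      using that q_gt_1 True
      by (intro sum.mono_neutral_right ballI sum_powers_monics) auto
    then show ?thesis
      using True by (simp add: monics_0)
  next
    case False
    have "n \<le> n * (q - 1)"
      using mult_le_mono2[of 1 "q - 1" n] q_gt_1 by linarith
    with that have "N < n * (q - 1)"
      by (rule less_le_trans)
    then show ?thesis
      using False assms by (simp add: trivial_zeros)
  qed
  then have "\<forall>\<^sub>F n in sequentially. (\<Sum>e<n. \<Sum>a\<in>monics e. val a ^ N) = (if N = 0 then 1 else 0)"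
    using eventually_gt_at_top by (rule eventually_mono[rotated])
  then show ?thesis
    by (rule tendsto_eventually)
qed

text \<open>
  At \<open>\<theta>\<^bsup>q^k\<^esup>\<close>, the quotient of \<open>\<chi>\<^sub>U(a)\<close> by \<open>a\<^bsup>|U|\<^esup>\<close> is \<open>a\<close> to this power.  It is divisible by \<open>q - 1\<close>,
  so its positive values lead to trivial zeros, and it takes the values 0 and \<open>q - 1\<close> only
  for the zero multi-index and for the unit multi-indices.
\<close>

definition excess :: "nat set \<Rightarrow> (nat \<Rightarrow> nat) \<Rightarrow> nat" where
  "excess U k = (\<Sum>r\<in>U. q ^ k r - 1)"

lemma twist_exp_eq: "twist_exp U k = card U + excess U k"
proof -
  have "twist_exp U k = (\<Sum>r\<in>U. 1 + (q ^ k r - 1))"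
    unfolding twist_exp_def using q_gt_1 by (intro sum.cong) auto
  then show ?thesis
    by (simp only: excess_def sum.distrib card_eq_sum)
qed

lemma excess_dvd: "(q - 1) dvd excess U k"
  unfolding excess_def by (intro dvd_sum q_minus_1_dvd)

lemma q_power_minus_1_cases:
  "(n = 0 \<and> q ^ n - 1 = 0) \<or> (n = 1 \<and> q ^ n - 1 = q - 1) \<or> (2 \<le> n \<and> q - 1 < q ^ n - 1)"
proof -
  have "q ^ 1 < q ^ n" if "2 \<le> n"
    using that q_gt_1 by (intro power_strict_increasing) auto
  then show ?thesis
    using q_gt_1 by (cases "n = 0"; cases "n = 1") auto
qed

lemma excess_eq_0:
  assumes "finite U"
  shows "excess U k = 0 \<longleftrightarrow> (\<forall>r\<in>U. k r = 0)"
proof -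
  have "q ^ n - 1 = 0 \<longleftrightarrow> n = 0" for n
    using q_power_minus_1_cases[of n] q_gt_1 by auto
  then show ?thesis
    using assms unfolding excess_def by (simp only: sum_eq_0_iff)
qed

lemma excess_le_imp:
  assumes "finite U" "excess U k \<le> q - 1" "r \<in> U"
  shows "k r \<le> 1"
proof -
  have "q ^ k r - 1 \<le> excess U k"
    unfolding excess_def using assms by (intro member_le_sum) auto
  then show ?thesis
    using assms(2) q_power_minus_1_cases[of "k r"] by auto
qed

lemma excess_eq_q_minus_1:
  assumes "finite U" "excess U k = q - 1"
  obtains r where "r \<in> U" "k r = 1" "\<And>s. s \<in> U - {r} \<Longrightarrow> k s = 0"
proof -
  have "\<exists>r\<in>U. k r \<noteq> 0"
    using excess_eq_0[OF assms(1), of k] assms(2) q_gt_1 by auto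
  then obtain r where r: "r \<in> U" "k r \<noteq> 0"
    by blast
  then have "k r = 1"
    using excess_le_imp[OF assms(1) _ r(1), of k] assms(2) by simp
  have "excess U k = (q ^ k r - 1) + excess (U - {r}) k"
    unfolding excess_def using assms(1) r(1) by (rule sum.remove)
  then have "excess (U - {r}) k = 0"
    using assms(2) \<open>k r = 1\<close> by simp
  then show ?thesis
    using that[OF r(1) \<open>k r = 1\<close>] excess_eq_0[of "U - {r}" k] assms(1) by simp
qed

lemma excess_single:
  assumes "finite U" "r \<in> U"
  shows "excess U (\<lambda>s\<in>U. if s = r then 1 else 0) = q - 1"
proof -
  have "excess U (\<lambda>s\<in>U. if s = r then 1 else 0) = (\<Sum>s\<in>U. if s = r then q - 1 else 0)"
    unfolding excess_def by (intro sum.cong) auto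
  then show ?thesis
    using assms by simp
qed

text \<open>
  The zeta value of type \<open>U\<close> and weight \<open>|U|\<close> is 1 at \<open>\<theta>\<close> and has a trivial zero at every other
  Frobenius twist.
\<close>

lemma trunc_limit_weight_card:
  "(\<lambda>n. trunc [(U, card U)] n (theta_pow \<iota> k)) \<longlonglongrightarrow> (if excess U k = 0 then 1 else 0)"
  using power_sums_limit[OF excess_dvd] by (simp add: psum_theta_pow_ge twist_exp_eq)

lemma trunc_limit_weight_card_plus:
  assumes "0 < excess U k"
  shows "(\<lambda>n. trunc [(U, card U + (q - 1))] n (theta_pow \<iota> k))
    \<longlonglongrightarrow> (if excess U k = q - 1 then 1 else 0)"
proof -
  have le: "q - 1 \<le> excess U k"
    using assms excess_dvd by (rule dvd_imp_le[rotated])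
  have "(q - 1) dvd (excess U k - (q - 1))"
    using excess_dvd by (rule dvd_diff_nat) simp
  from power_sums_limit[OF this] le show ?thesis
    by (simp add: psum_theta_pow_ge twist_exp_eq)
qed

text \<open>
  At \<open>\<theta>\<close> itself the twist cancels \<open>a\<^bsup>|U|\<^esup>\<close>, so an untwisted zeta value remains.
\<close>

lemma trunc_excess_0:
  assumes "excess U k = 0"
  shows "trunc [(U, card U + s)] n (theta_pow \<iota> k) = trunc [({}, s)] n (theta_pow \<iota> k)"
  using assms by (simp add: psum_theta_pow_le twist_exp_eq excess_def[of "{}"])

text \<open>
  The Carlitz logarithm of 1, which is also the zeta value \<open>\<zeta>\<^sub>A(1)\<close>.
\<close>

definition log_1 :: 'c where
  "log_1 = lim (\<lambda>n. \<Sum>i<n. 1 / ell \<iota> i)"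

lemma absv_ell: "2 ^ n \<le> absv (ell \<iota> n)"
proof (induction n)
  case (Suc n)
  have "1 < q ^ Suc n"
    using q_gt_1 by (intro one_less_power) auto
  then have "(2::real) ^ 1 < 2 ^ (q ^ Suc n)"
    by (intro power_strict_increasing) auto
  then have "absv (\<theta> + - (\<theta> ^ (q ^ Suc n))) = 2 ^ (q ^ Suc n)"
    by (subst absv_add_eq) (simp_all add: absv_power absv_theta del: power_Suc)
  then have "absv (ell \<iota> (Suc n)) = absv (ell \<iota> n) * 2 ^ (q ^ Suc n)"
    by (simp add: ell_Suc dist_mult_0 del: power_Suc)
  moreover have "2 ^ n * 2 ^ 1 \<le> absv (ell \<iota> n) * 2 ^ (q ^ Suc n)"
    using Suc.IH \<open>(2::real) ^ 1 < 2 ^ (q ^ Suc n)\<close> by (intro mult_mono) auto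
  ultimately show ?case
    by simp
qed simp

lemma absv_inverse_ell: "absv (1 / ell \<iota> n) \<le> (1 / 2) ^ n"
  using absv_ell[of n] by (simp add: absv_divide field_simps)

lemma inverse_ell_tendsto_0: "(\<lambda>n. 1 / ell \<iota> n) \<longlonglongrightarrow> 0"
proof -
  have "(\<lambda>n. absv (1 / ell \<iota> n)) \<longlonglongrightarrow> 0"
    by (rule tendsto_sandwich[OF _ _ tendsto_const LIMSEQ_realpow_zero[of "1 / 2"]])
      (use absv_inverse_ell in auto)
  then show ?thesis
    by (subst tendsto_dist_iff)
qed

lemma log_1_limit: "(\<lambda>n. \<Sum>i<n. 1 / ell \<iota> i) \<longlonglongrightarrow> log_1"
  using nonarch_convergent_sum[OF inverse_ell_tendsto_0]
  by (simp add: log_1_def convergent_LIMSEQ_iff)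

lemma trunc_weight_1: "trunc [({}, 1)] n t = (\<Sum>i<n. 1 / ell \<iota> i)"
  by (simp add: psum_def chi_def sum_inverse_monics)

lemma trunc_power_in_span: "(\<lambda>x. trunc [({}, 1)] (fst x) (snd x) ^ n) \<in> trunc_span {} n"
proof (induction n)
  case 0
  then show ?case
    using trunc_in_span[of "{}" "[]" 0] by simp
next
  case (Suc n)
  have "(\<lambda>x. trunc [({}, 1)] (fst x) (snd x)) \<in> trunc_span {} 1"
    by (rule trunc_in_span) (simp_all add: admissible_Cons)
  from trunc_span_mult[OF this Suc] show ?case
    by (simp del: trunc.simps)
qed

text \<open>
  With \<open>m = |\<Sigma>|\<close> and \<open>\<zeta>(\<Sigma>; s)\<close> for the zeta value of depth one, the element is
  \<open>\<zeta>(\<Sigma>; m + q - 1) - \<zeta>(q - 1) \<zeta>(\<Sigma>; m) - m / (\<theta>\<^sup>q - \<theta>) \<zeta>(1)\<^bsup>q-1\<^esup> \<zeta>(\<Sigma>; m)\<close>.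
  The factor \<open>\<zeta>(\<Sigma>; m)\<close> is nonzero only at \<open>\<theta>\<close>, so the second and third terms change only the
  value at \<open>\<theta>\<close>: the second one cancels the value \<open>\<zeta>(q - 1)\<close> of the first term, and the third
  one replaces it by the value that makes the image under \<open>G\<close> vanish.
\<close>

lemma kernel_element:
  assumes "finite \<Sigma>" "\<Sigma> \<noteq> {}"
  obtains f where "f \<in> Z_space \<iota> \<Sigma> (card \<Sigma> + (q - 1))"
    and "\<And>k. f (theta_pow \<iota> k) =
      (if excess \<Sigma> k = 0 then - (of_nat (card \<Sigma>) / (\<theta> ^ q - \<theta>) * log_1 ^ (q - 1))
       else if excess \<Sigma> k = q - 1 then 1 else 0)"
proof -
  define m where "m = card \<Sigma>"
  have "0 < m"
    using assms by (simp add: m_def card_gt_0_iff)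
  define c where "c = of_nat m / (\<theta> ^ q - \<theta>)"
  have "c \<in> K"
    unfolding c_def using K_add[OF K_power[OF theta_in_K] K_uminus[OF theta_in_K], of q]
    by (intro K_divide K_of_nat) simp
  \<comment> \<open>The truncations of \<open>\<zeta>(\<Sigma>; m + q - 1)\<close>, \<open>\<zeta>(\<Sigma>; m)\<close>, \<open>\<zeta>(q - 1)\<close> and \<open>\<zeta>(1)\<^bsup>q-1\<^esup>\<close>.\<close>
  define A where "A x = trunc [(\<Sigma>, m + (q - 1))] (fst x) (snd x)" for x
  define B where "B x = trunc [(\<Sigma>, m)] (fst x) (snd x)" for x
  define C where "C x = trunc [({}, q - 1)] (fst x) (snd x)" for x
  define D where "D x = trunc [({}, 1)] (fst x) (snd x) ^ (q - 1)" for x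
  define F where "F x = A x - C x * B x - c * (D x * B x)" for x
  have "A \<in> trunc_span \<Sigma> (m + (q - 1))" "B \<in> trunc_span \<Sigma> m" "C \<in> trunc_span {} (q - 1)"
    unfolding A_def B_def C_def using \<open>0 < m\<close> q_gt_1
    by (intro trunc_in_span; simp add: admissible_Cons)+
  moreover have "D \<in> trunc_span {} (q - 1)"
    unfolding D_def by (rule trunc_power_in_span)
  ultimately have "(\<lambda>x. C x * B x) \<in> trunc_span \<Sigma> (m + (q - 1))"
      "(\<lambda>x. D x * B x) \<in> trunc_span \<Sigma> (m + (q - 1))"
    using trunc_span_mult[of _ "{}" "q - 1" B \<Sigma> m] assms(1) by (simp_all add: add.commute)
  with \<open>A \<in> _\<close> \<open>c \<in> K\<close> have "F \<in> trunc_span \<Sigma> (m + (q - 1))"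
    unfolding F_def trunc_span_def by (intro lin_span_diff lin_span_cmult)
  then obtain f where f: "f \<in> Z_space \<iota> \<Sigma> (m + (q - 1))"
    "\<And>k. (\<lambda>N. F (N, theta_pow \<iota> k)) \<longlonglongrightarrow> f (theta_pow \<iota> k)"
    by (rule trunc_span_limit) blast
  have "f (theta_pow \<iota> k) = (if excess \<Sigma> k = 0 then - (c * log_1 ^ (q - 1))
       else if excess \<Sigma> k = q - 1 then 1 else 0)" for k
  proof -
    have B: "(\<lambda>N. B (N, theta_pow \<iota> k)) \<longlonglongrightarrow> (if excess \<Sigma> k = 0 then 1 else 0)"
      unfolding B_def fst_conv snd_conv m_def by (rule trunc_limit_weight_card)
    obtain z where C: "(\<lambda>N. C (N, theta_pow \<iota> k)) \<longlonglongrightarrow> z"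
      using trunc_theta_pow_convergent[of "[({}, q - 1)]" k] unfolding C_def convergent_def by auto
    have D: "(\<lambda>N. D (N, theta_pow \<iota> k)) \<longlonglongrightarrow> log_1 ^ (q - 1)"
      unfolding D_def fst_conv snd_conv trunc_weight_1
      by (intro tendsto_power_strong log_1_limit tendsto_const)
    show ?thesis
    proof (cases "excess \<Sigma> k = 0")
      case True
      have "A (N, theta_pow \<iota> k) = C (N, theta_pow \<iota> k)" for N
        unfolding A_def C_def fst_conv snd_conv m_def using True by (rule trunc_excess_0)
      then have "(\<lambda>N. A (N, theta_pow \<iota> k)) \<longlonglongrightarrow> z"
        using C by simp
      then have "(\<lambda>N. F (N, theta_pow \<iota> k)) \<longlonglongrightarrow> z - z * 1 - c * (log_1 ^ (q - 1) * 1)"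
        unfolding F_def using B C D True
        by (intro tendsto_diff tendsto_mult tendsto_const) simp_all
      from LIMSEQ_unique[OF f(2) this] show ?thesis
        using True by simp
    next
      case False
      have "(\<lambda>N. A (N, theta_pow \<iota> k)) \<longlonglongrightarrow> (if excess \<Sigma> k = q - 1 then 1 else 0)"
        unfolding A_def fst_conv snd_conv m_def using False
        by (intro trunc_limit_weight_card_plus) simp
      then have "(\<lambda>N. F (N, theta_pow \<iota> k))
          \<longlonglongrightarrow> (if excess \<Sigma> k = q - 1 then 1 else 0) - z * 0 - c * (log_1 ^ (q - 1) * 0)"
        unfolding F_def using B C D False
        by (intro tendsto_diff tendsto_mult tendsto_const) simp_all
      from LIMSEQ_unique[OF f(2) this] show ?thesis
        using False by simp
    qed
  qed
  with f(1) that show ?thesis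
    unfolding m_def c_def by blast
qed

lemma Z_triv_weight_subset:
  assumes "f \<in> Z_triv_weight \<iota> \<Sigma> n"
  shows "f \<in> Z_triv \<iota> \<Sigma>"
proof -
  have zero: "(\<lambda>_. 0) \<in> Z_triv_weight \<iota> \<Sigma> n" for n
    using lin_span_subset_K_span[OF lin_span.zero] by (simp add: Z_triv_weight_def Z_space_def)
  define g where "g i = (if i = n then f else (\<lambda>_. 0))" for i
  have "f = (\<lambda>t. \<Sum>i<Suc n. g i t)"
    by (simp add: g_def fun_eq_iff)
  moreover have "\<forall>i<Suc n. g i \<in> Z_triv_weight \<iota> \<Sigma> i"
    using assms zero by (simp add: g_def)
  ultimately show ?thesis
    unfolding Z_triv_def by blast
qed

lemma zero_in_Z_triv: "(\<lambda>_. 0) \<in> Z_triv \<iota> \<Sigma>"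
  by (rule Z_triv_weight_subset[of _ _ 0])
    (use lin_span_subset_K_span[OF lin_span.zero] in \<open>simp add: Z_triv_weight_def Z_space_def\<close>)

section \<open>The map \<open>G\<close> on values of finite support\<close>

text \<open>
  The coefficient of \<open>X\<^bsup>q^b\<^esup>\<close> in the power \<open>q\<^sup>a\<close> of the Carlitz logarithm
  \<open>\<Sum> X\<^bsup>q^i\<^esup> / \<ell>\<^sub>i\<close>: the Frobenius shifts the series by \<open>a\<close> places.
\<close>

definition log_coeff :: "nat \<Rightarrow> nat \<Rightarrow> 'c" where
  "log_coeff a b = (if a \<le> b then 1 / ell \<iota> (b - a) ^ (q ^ a) else 0)"

lemma log_coeff_shift: "log_coeff a (b + a) = (1 / ell \<iota> b) ^ (q ^ a)"
  by (simp add: log_coeff_def power_one_over)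

lemma log_coeff_sum_limit: "(\<lambda>n. \<Sum>b<n. log_coeff a b) \<longlonglongrightarrow> log_1 ^ (q ^ a)"
proof (rule LIMSEQ_offset[where k = a])
  have "(\<Sum>b<n + a. log_coeff a b) = (\<Sum>b<n. 1 / ell \<iota> b) ^ (q ^ a)" for n
    unfolding frobenius_sum log_coeff_shift[symmetric]
    by (induction n) (simp_all add: log_coeff_def)
  then show "(\<lambda>n. \<Sum>b<n + a. log_coeff a b) \<longlonglongrightarrow> log_1 ^ (q ^ a)"
    by (simp add: tendsto_power_strong log_1_limit)
qed

lemma log_coeff_tendsto_0: "log_coeff a \<longlonglongrightarrow> 0"
proof (rule LIMSEQ_offset[where k = a])
  have "(\<lambda>b. (1 / ell \<iota> b) ^ (q ^ a)) \<longlonglongrightarrow> 0 ^ (q ^ a)"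
    by (intro tendsto_power_strong inverse_ell_tendsto_0 tendsto_const)
  then show "(\<lambda>b. log_coeff a (b + a)) \<longlonglongrightarrow> 0"
    using q_gt_1 by (simp add: log_coeff_shift power_0_left)
qed

lemma absv_log_coeff: "absv (log_coeff a b) \<le> 1"
proof -
  have "1 \<le> absv (ell \<iota> n)" for n
    using absv_ell[of n] one_le_power[of "2::real" n] by linarith
  then show ?thesis
    by (simp add: log_coeff_def absv_divide absv_power one_le_power divide_le_eq_1)
qed

lemma log_product_has_sum:
  assumes "finite \<Sigma>"
  shows "((\<lambda>i. \<Prod>r\<in>\<Sigma>. log_coeff (j r) (i r)) has_sum log_1 ^ twist_exp \<Sigma> j) (multi_indices \<Sigma>)"
  using nonarch_has_sum_prod[OF assms log_coeff_sum_limit log_coeff_tendsto_0 absv_log_coeff, of j]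
  by (simp add: multi_indices_def twist_exp_def power_sum)

text \<open>
  When only finitely many values are nonzero, the sum over \<open>j\<close> may be taken out of the series.
  What remains for each \<open>j\<close> is a product over \<open>\<Sigma>\<close> of twisted Carlitz logarithms at 1.
\<close>

lemma G_map_finite_support:
  assumes fin: "finite \<Sigma>" and J: "finite J" "J \<subseteq> multi_indices \<Sigma>"
    and supp: "\<And>j. j \<in> multi_indices \<Sigma> - J \<Longrightarrow> f (theta_pow \<iota> j) = 0"
  shows "G_map \<iota> \<Sigma> f
    = (\<Sum>j\<in>J. f (theta_pow \<iota> j) / (\<Prod>r\<in>\<Sigma>. DD \<iota> (j r)) * log_1 ^ twist_exp \<Sigma> j)"
    (is "_ = ?s")
proof -
  define c where "c j = f (theta_pow \<iota> j) / (\<Prod>r\<in>\<Sigma>. DD \<iota> (j r))" for j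
  define C where "C i = (\<Sum>j\<in>J. c j * (\<Prod>r\<in>\<Sigma>. log_coeff (j r) (i r)))" for i
  have C: "(C has_sum ?s) (multi_indices \<Sigma>)"
    unfolding C_def c_def by (intro has_sum_sum has_sum_cmult_right log_product_has_sum fin)
  have inj: "inj_on (q_pow q \<Sigma>) (multi_indices \<Sigma>)"
  proof (rule inj_onI)
    fix i j
    assume ij: "i \<in> multi_indices \<Sigma>" "j \<in> multi_indices \<Sigma>" "q_pow q \<Sigma> i = q_pow q \<Sigma> j"
    have "i r = j r" if "r \<in> \<Sigma>" for r
      using fun_cong[OF ij(3), of r] that q_gt_1 by (simp add: q_pow_def)
    then show "i = j"
      using ij(1,2) by (intro PiE_ext) (auto simp: multi_indices_def)
  qed
  have on_powers: "F_map \<iota> \<Sigma> f (q_pow q \<Sigma> i) = C i" if i: "i \<in> multi_indices \<Sigma>" for i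
  proof -
    define I where "I = {j \<in> multi_indices \<Sigma>. \<forall>r\<in>\<Sigma>. j r \<le> i r}"
    have "I = (\<Pi>\<^sub>E r\<in>\<Sigma>. {..i r})"
      by (auto simp: I_def multi_indices_def PiE_iff extensional_def)
    then have "finite I"
      using fin by (simp add: finite_PiE)
    have "{i' \<in> multi_indices \<Sigma>. q_pow q \<Sigma> i' = q_pow q \<Sigma> i} = {i}"
      using i inj by (auto simp: inj_on_def)
    then have "F_map \<iota> \<Sigma> f (q_pow q \<Sigma> i) = (\<Sum>j\<in>I. f (theta_pow \<iota> j)
        / ((\<Prod>r\<in>\<Sigma>. DD \<iota> (j r)) * (\<Prod>r\<in>\<Sigma>. ell \<iota> (i r - j r) ^ (q ^ j r))))"
      by (simp add: F_map_def I_def flip: q_def)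
    also have "\<dots> = (\<Sum>j\<in>I. c j * (\<Prod>r\<in>\<Sigma>. log_coeff (j r) (i r)))"
      by (intro sum.cong) (simp_all add: I_def c_def log_coeff_def prod_dividef)
    also have "\<dots> = (\<Sum>j\<in>I \<inter> J. c j * (\<Prod>r\<in>\<Sigma>. log_coeff (j r) (i r)))"
      using \<open>finite I\<close> supp by (intro sum.mono_neutral_right) (auto simp: I_def c_def)
    also have "\<dots> = C i"
      unfolding C_def
    proof (intro sum.mono_neutral_left J ballI)
      fix j
      assume "j \<in> J - I \<inter> J"
      then obtain r where "r \<in> \<Sigma>" "log_coeff (j r) (i r) = 0"
        using J(2) by (auto simp: I_def log_coeff_def)
      then show "c j * (\<Prod>r\<in>\<Sigma>. log_coeff (j r) (i r)) = 0"
        using fin by (simp add: prod_zero_iff) blast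
    qed auto
    finally show ?thesis .
  qed
  have off_powers: "F_map \<iota> \<Sigma> f e = 0" if "e \<notin> q_pow q \<Sigma> ` multi_indices \<Sigma>" for e
  proof -
    have empty: "{i \<in> multi_indices \<Sigma>. q_pow q \<Sigma> i = e} = {}"
      using that by blast
    show ?thesis
      unfolding F_map_def q_def[symmetric] empty by simp
  qed
  have "((F_map \<iota> \<Sigma> f \<circ> q_pow q \<Sigma>) has_sum ?s) (multi_indices \<Sigma>)"
    using C on_powers by (simp cong: has_sum_cong)
  then have "(F_map \<iota> \<Sigma> f has_sum ?s) (q_pow q \<Sigma> ` multi_indices \<Sigma>)"
    using has_sum_reindex[OF inj] by blast
  moreover have "q_pow q \<Sigma> ` multi_indices \<Sigma> \<subseteq> multi_indices \<Sigma>"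
    by (auto simp: q_pow_def multi_indices_def)
  ultimately have "(F_map \<iota> \<Sigma> f has_sum ?s) (multi_indices \<Sigma>)"
    using off_powers
    by (subst (asm) has_sum_cong_neutral[where T = "multi_indices \<Sigma>" and g = "F_map \<iota> \<Sigma> f"]) auto
  then show ?thesis
    by (simp add: G_map_def ev_def eval_series_def infsumI)
qed

text \<open>
  By the preceding formula the value at \<open>\<theta>\<close> contributes
  \<open>- m / (\<theta>\<^sup>q - \<theta>) \<cdot> L\<^bsup>m+q-1\<^esup>\<close>, where \<open>m = |\<Sigma>|\<close> and \<open>L = log_1\<close>.  Each of the \<open>m\<close> unit multi-indices
  contributes \<open>L\<^bsup>m+q-1\<^esup> / (\<theta>\<^sup>q - \<theta>)\<close>.
\<close>

theorem G_map_not_injective: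
  assumes "finite \<Sigma>" "\<Sigma> \<noteq> {}"
  shows "\<not> inj_on (G_map \<iota> \<Sigma>) (Z_triv \<iota> \<Sigma>)"
proof
  assume inj: "inj_on (G_map \<iota> \<Sigma>) (Z_triv \<iota> \<Sigma>)"
  obtain f where f_span: "f \<in> Z_space \<iota> \<Sigma> (card \<Sigma> + (q - 1))"
    and f: "\<And>k. f (theta_pow \<iota> k) =
      (if excess \<Sigma> k = 0 then - (of_nat (card \<Sigma>) / (\<theta> ^ q - \<theta>) * log_1 ^ (q - 1))
       else if excess \<Sigma> k = q - 1 then 1 else 0)"
    using kernel_element[OF assms] by blast
  define z :: "nat \<Rightarrow> nat" where "z = (\<lambda>s\<in>\<Sigma>. 0)"
  define e :: "nat \<Rightarrow> nat \<Rightarrow> nat" where "e r = (\<lambda>s\<in>\<Sigma>. if s = r then 1 else 0)" for r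
  define J where "J = insert z (e ` \<Sigma>)"
  have J: "finite J" "J \<subseteq> multi_indices \<Sigma>"
    using assms(1) by (auto simp: J_def z_def e_def multi_indices_def)
  have supp: "f (theta_pow \<iota> j) = 0" if j: "j \<in> multi_indices \<Sigma> - J" for j
  proof -
    have "excess \<Sigma> j \<noteq> 0"
    proof
      assume "excess \<Sigma> j = 0"
      then have "\<And>r. r \<in> \<Sigma> \<Longrightarrow> j r = 0"
        using excess_eq_0[OF assms(1)] by blast
      then have "j = z"
        using j by (auto simp: z_def multi_indices_def PiE_iff extensional_def fun_eq_iff)
      then show False
        using j by (simp add: J_def)
    qed
    moreover have "excess \<Sigma> j \<noteq> q - 1"
    proof
      assume "excess \<Sigma> j = q - 1"
      then obtain r where r: "r \<in> \<Sigma>" "j r = 1" "\<And>s. s \<in> \<Sigma> - {r} \<Longrightarrow> j s = 0"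
        using excess_eq_q_minus_1[OF assms(1)] by blast
      then have "j = e r"
        using j by (auto simp: e_def multi_indices_def PiE_iff extensional_def fun_eq_iff)
      then show False
        using j r(1) by (simp add: J_def)
    qed
    ultimately show ?thesis
      by (simp add: f)
  qed
  have ex_z: "excess \<Sigma> z = 0"
    using excess_eq_0[OF assms(1), of z] by (simp add: z_def)
  have ex_e: "excess \<Sigma> (e r) = q - 1" if "r \<in> \<Sigma>" for r
    unfolding e_def using assms(1) that by (rule excess_single)
  have "f \<in> Z_triv \<iota> \<Sigma>"
  proof (rule Z_triv_weight_subset)
    have "{k \<in> multi_indices \<Sigma>. f (theta_pow \<iota> k) \<noteq> 0} \<subseteq> J"
      using supp by blast
    then show "f \<in> Z_triv_weight \<iota> \<Sigma> (card \<Sigma> + (q - 1))"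
      using f_span J(1) by (auto simp: Z_triv_weight_def intro: finite_subset)
  qed
  moreover have "(\<lambda>_. 0) \<in> Z_triv \<iota> \<Sigma>"
    by (rule zero_in_Z_triv)
  moreover have "G_map \<iota> \<Sigma> f = 0"
  proof -
    define m where "m = card \<Sigma>"
    define D where "D = \<theta> ^ q - \<theta>"
    define g where "g j = f (theta_pow \<iota> j) / (\<Prod>r\<in>\<Sigma>. DD \<iota> (j r)) * log_1 ^ twist_exp \<Sigma> j" for j
    have "(\<Prod>s\<in>\<Sigma>. DD \<iota> (z s)) = 1"
      by (simp add: z_def)
    then have g_z: "g z = - (of_nat m / D * log_1 ^ (q - 1)) * log_1 ^ m"
      by (simp add: g_def f ex_z twist_exp_eq m_def D_def)
    have g_e: "g (e r) = 1 / D * (log_1 ^ (q - 1) * log_1 ^ m)" if r: "r \<in> \<Sigma>" for r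
    proof -
      have "(\<Prod>s\<in>\<Sigma>. DD \<iota> (e r s)) = (\<Prod>s\<in>\<Sigma>. if s = r then D else 1)"
        by (intro prod.cong) (auto simp: e_def D_def DD_1[unfolded One_nat_def])
      also have "\<dots> = D"
        using r assms(1) by simp
      finally have "(\<Prod>s\<in>\<Sigma>. DD \<iota> (e r s)) = D" .
      moreover have "log_1 ^ twist_exp \<Sigma> (e r) = log_1 ^ (q - 1) * log_1 ^ m"
        by (simp only: twist_exp_eq ex_e[OF r] m_def power_add mult.commute)
      moreover have "f (theta_pow \<iota> (e r)) = 1"
        using q_gt_1 f[of "e r"] ex_e[OF r] by simp
      ultimately show ?thesis
        by (simp add: g_def)
    qed
    have "z \<notin> e ` \<Sigma>"
      using ex_z ex_e q_gt_1 by force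
    moreover have "inj_on e \<Sigma>"
    proof (rule inj_onI)
      fix r s
      assume "r \<in> \<Sigma>" "e r = e s"
      then have "e s r = e r r"
        by simp
      with \<open>r \<in> \<Sigma>\<close> show "r = s"
        by (simp add: e_def split: if_splits)
    qed
    ultimately have "(\<Sum>j\<in>J. g j) = g z + (\<Sum>r\<in>\<Sigma>. g (e r))"
      unfolding J_def using assms(1) by (simp add: sum.reindex)
    also have "\<dots> = 0"
      using g_e by (simp add: g_z m_def)
    finally show ?thesis
      using G_map_finite_support[where f = f, OF assms(1) J supp] by (simp add: g_def)
  qed
  moreover have "G_map \<iota> \<Sigma> (\<lambda>_. 0) = 0"
    using G_map_finite_support[OF assms(1), of "{}" "\<lambda>_. 0"] by simp
  ultimately have "f = (\<lambda>_. 0)"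
    using inj by (metis inj_onD)
  moreover obtain r where "r \<in> \<Sigma>"
    using assms(2) by blast
  moreover have "f (theta_pow \<iota> (e r)) = 1"
    using f[of "e r"] ex_e[OF \<open>r \<in> \<Sigma>\<close>] q_gt_1 by simp
  ultimately show False
    by simp
qed

end

theorem corollary0p3:
  fixes \<iota> :: "'q::finite_field fls \<Rightarrow> 'c::{nonarch_field, complete_space}"
    and \<Sigma> :: "nat set"
  assumes "is_C_infinity \<iota>"
    and "finite \<Sigma>" and "\<Sigma> \<subseteq> {1..}" and "card \<Sigma> < CARD('q)"
    and "\<Sigma> \<noteq> {}"
  shows "\<not> inj_on (G_map \<iota> \<Sigma>) (Z_triv \<iota> \<Sigma>)"
proof -
  interpret carlitz \<iota> "CARD('q)"
    by unfold_locales (use assms(1) in auto)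
  show ?thesis
    using assms(2,5) by (rule G_map_not_injective)
qed

end
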